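(* Let $G$ be a locally compact abelian group with a compact open subgroup $H$, and let $A\in\operatorname{Aut}(G)$ be expansive with respect to $H$ and such that $A^*$ is expansive with respect to $H^\perp$. Let $\varphi\in L^2(G)$ and let $\Lambda\subseteq G\times\widehat{G}$. If $S(\varphi,\Lambda)$ is a Bessel sequence in $L^2(G)$, then $D^+(\Lambda)<\infty$.
   Context: Locally compact abelian (LCA) groups are Hausdorff and written additively; $\widehat{G}$ is the Pontryagin dual, $\langle x,\xi\rangle$ denotes the character $\xi$ evaluated at $x$, and $H^\perp=\{\xi\in\widehat{G}:\langle h,\xi\rangle=1\ \forall h\in H\}$. Haar measures are normalized by $m_G(H)=1$, $m_{\widehat{G}}(H^\perp)=1$. $\operatorname{Aut}(G)$ is the group of homeomorphic automorphisms of $G$; the modulus $|A|>0$ of $A\in\operatorname{Aut}(G)$ is defined by $m_G(AU)=|A|\,m_G(U)$ for Borel $U$; the adjoint $A^*\in\operatorname{Aut}(\widehat{G})$ is given by $\langle Ax,\gamma\rangle=\langle x,A^*\gamma\rangle$. $A$ is expansive with respect to a compact open subgroup $H$ if $H\subsetneq AH$ and $\bigcap_{n\le0}A^nH=\{0\}$. For $n\in\mathbb{Z}$ and $(x,\xi)\in G\times\widehat{G}$, $Q_n(x,\xi)=(x+A^nH)\times(\xi+(A^* )^nH^\perp)$. The upper density is $$D^+(\Lambda)=\limsup_{n\to+\infty}\frac{1}{|A|^{2n}}\max_{(x,\xi)\in G\times\widehat{G}}\#\{\Lambda\cap Q_n(x,\xi)\},$$ where the maximum may be $+\infty$. Translation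 and modulation on $L^2(G)$: $T_xf(y)=f(y-x)$, $M_\xi f(y)=\langle y,\xi\rangle f(y)$. The Gabor system is $S(\varphi,\Lambda)=\{M_\xi T_x\varphi\}_{(x,\xi)\in\Lambda}$. A family $\{\varphi_i\}_{i\in I}$ in a Hilbert space $\mathcal{H}$ is a Bessel sequence if there is $B>0$ with $\sum_{i\in I}|\langle f,\varphi_i\rangle|^2\le B\|f\|^2$ for all $f\in\mathcal{H}$.
   Formalization: The formal theorem assumes in addition that φ is nonzero in L²(G); for φ = 0 the claim fails, since Λ = G × Ĝ gives a Bessel family of zero vectors while D⁺(Λ) = ∞. *)

theory Defs
  imports "HOL-Analysis.Analysis"
begin

section \<open>The Pontryagin dual\<close>

typedef (overloaded) ('a::topological_ab_group_add) dual =
  "{u :: 'a \<Rightarrow> complex. continuous_on UNIV u \<and> (\<forall>x. cmod (u x) = 1)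
      \<and> (\<forall>x y. u (x + y) = u x * u y)}"
  morphisms char_of Abs_dual
  by (rule exI[of _ "\<lambda>_. 1"]) simp

definition pairing :: "'a::topological_ab_group_add \<Rightarrow> 'a dual \<Rightarrow> complex" where
  "pairing x \<xi> = char_of \<xi> x"

lemma pairing_continuous: "continuous_on UNIV (\<lambda>x. pairing x \<xi>)"
  and norm_pairing [simp]: "cmod (pairing x \<xi>) = 1"
  and pairing_add_left: "pairing (x + y) \<xi> = pairing x \<xi> * pairing y \<xi>"
  using char_of[of \<xi>] by (simp_all add: pairing_def)

lemma pairing_nonzero [simp]: "pairing x \<xi> \<noteq> 0"
  using norm_pairing[of x \<xi>] by force

lemma dual_eqI: "(\<And>x. pairing x \<xi> = pairing x \<eta>) \<Longrightarrow> \<xi> = \<eta>"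
  unfolding pairing_def by (metis char_of_inject ext)

lemma pairing_Abs_dual:
  assumes "continuous_on UNIV u" "\<And>x. cmod (u x) = 1" "\<And>x y. u (x + y) = u x * u y"
  shows "pairing x (Abs_dual u) = u x"
  using assms by (simp add: pairing_def Abs_dual_inverse)

instantiation dual :: (topological_ab_group_add) ab_group_add
begin

definition zero_dual :: "'a dual" where
  "0 = Abs_dual (\<lambda>_. 1)"

definition plus_dual :: "'a dual \<Rightarrow> 'a dual \<Rightarrow> 'a dual" where
  "\<xi> + \<eta> = Abs_dual (\<lambda>x. pairing x \<xi> * pairing x \<eta>)"

definition uminus_dual :: "'a dual \<Rightarrow> 'a dual" where
  "- \<xi> = Abs_dual (\<lambda>x. cnj (pairing x \<xi>))"

definition minus_dual :: "'a dual \<Rightarrow> 'a dual \<Rightarrow> 'a dual" where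
  "\<xi> - \<eta> = \<xi> + - (\<eta> :: 'a dual)"

lemma pairing_zero_right [simp]: "pairing x (0 :: 'a dual) = 1"
  unfolding zero_dual_def by (subst pairing_Abs_dual) simp_all

lemma pairing_add_right: "pairing x (\<xi> + \<eta>) = pairing x \<xi> * pairing x (\<eta> :: 'a dual)"
  unfolding plus_dual_def
  by (subst pairing_Abs_dual)
    (auto intro!: continuous_intros pairing_continuous simp: norm_mult pairing_add_left)

lemma pairing_minus_right: "pairing x (- \<xi>) = cnj (pairing x (\<xi> :: 'a dual))"
  unfolding uminus_dual_def
  by (subst pairing_Abs_dual)
    (auto intro!: continuous_intros pairing_continuous simp: pairing_add_left)

instance
proof
  fix a b c :: "'a dual"
  show "a + b + c = a + (b + c)" "a + b = b + a" "0 + a = a"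
    by (auto intro!: dual_eqI simp: pairing_add_right)
  show "- a + a = 0"
  proof (rule dual_eqI)
    fix x
    have "cnj (pairing x a) * pairing x a = 1"
      using complex_norm_square[of "pairing x a"] by (simp add: mult.commute)
    then show "pairing x (- a + a) = pairing x 0"
      by (simp add: pairing_add_right pairing_minus_right)
  qed
  show "a - b = a + - b" by (rule minus_dual_def)
qed

end

text \<open>
  The compact-open topology, in its equivalent form as the topology of uniform convergence
  on compact sets.
\<close>

definition dual_nbhd :: "'a::topological_ab_group_add set \<Rightarrow> real \<Rightarrow> 'a dual \<Rightarrow> 'a dual set" where
  "dual_nbhd K e \<xi> = {\<eta>. \<forall>x\<in>K. cmod (pairing x \<eta> - pairing x \<xi>) < e}"

lemma dual_nbhd_mono: "K \<subseteq> K' \<Longrightarrow> e' \<le> e \<Longrightarrow> dual_nbhd K' e' \<xi> \<subseteq> dual_nbhd K e \<xi>"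
  unfolding dual_nbhd_def by force

lemma dual_nbhd_self: "e > 0 \<Longrightarrow> \<xi> \<in> dual_nbhd K e \<xi>"
  by (simp add: dual_nbhd_def)

instantiation dual :: (topological_ab_group_add) topological_space
begin

definition open_dual :: "'a dual set \<Rightarrow> bool" where
  "open U \<longleftrightarrow> (\<forall>\<xi>\<in>U. \<exists>K e. compact K \<and> e > 0 \<and> dual_nbhd K e \<xi> \<subseteq> U)"

instance
proof
  show "open (UNIV :: 'a dual set)"
    unfolding open_dual_def by (auto intro: exI[of _ "{}"] exI[of _ 1])
next
  fix S T :: "'a dual set"
  assume S: "open S" and T: "open T"
  show "open (S \<inter> T)"
    unfolding open_dual_def
  proof
    fix \<xi> assume "\<xi> \<in> S \<inter> T"
    then obtain K e L d where "compact K" "e > 0" "dual_nbhd K e \<xi> \<subseteq> S"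
      "compact L" "d > 0" "dual_nbhd L d \<xi> \<subseteq> T"
      using S T unfolding open_dual_def by (metis IntE)
    moreover from this have "dual_nbhd (K \<union> L) (min e d) \<xi> \<subseteq> S \<inter> T"
      using dual_nbhd_mono[of K "K \<union> L" "min e d" e \<xi>]
        dual_nbhd_mono[of L "K \<union> L" "min e d" d \<xi>] by auto
    ultimately show "\<exists>K e. compact K \<and> e > 0 \<and> dual_nbhd K e \<xi> \<subseteq> S \<inter> T"
      by (intro exI[of _ "K \<union> L"] exI[of _ "min e d"]) (auto intro: compact_Un)
  qed
next
  fix \<S> :: "'a dual set set"
  assume *: "\<forall>S\<in>\<S>. open S"
  show "open (\<Union>\<S>)"
    unfolding open_dual_def
  proof
    fix \<xi> assume "\<xi> \<in> \<Union>\<S>"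
    then obtain S where "S \<in> \<S>" "\<xi> \<in> S" by blast
    moreover from this * obtain K e where "compact K" "e > 0" "dual_nbhd K e \<xi> \<subseteq> S"
      unfolding open_dual_def by meson
    ultimately show "\<exists>K e. compact K \<and> e > 0 \<and> dual_nbhd K e \<xi> \<subseteq> \<Union>\<S>" by blast
  qed
qed

end

lemma eventually_nhds_dual:
  "eventually P (nhds \<xi>) \<longleftrightarrow> (\<exists>K e. compact K \<and> e > 0 \<and> (\<forall>\<eta>\<in>dual_nbhd K e \<xi>. P \<eta>))"
proof
  assume "eventually P (nhds \<xi>)"
  then obtain U where "open U" "\<xi> \<in> U" "\<forall>\<eta>\<in>U. P \<eta>"
    unfolding eventually_nhds by blast
  then show "\<exists>K e. compact K \<and> e > 0 \<and> (\<forall>\<eta>\<in>dual_nbhd K e \<xi>. P \<eta>)"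
    unfolding open_dual_def by (meson subsetD)
next
  assume "\<exists>K e. compact K \<and> e > 0 \<and> (\<forall>\<eta>\<in>dual_nbhd K e \<xi>. P \<eta>)"
  then obtain K e where K: "compact K" and e: "e > 0" and P: "\<forall>\<eta>\<in>dual_nbhd K e \<xi>. P \<eta>"
    by blast
  define U where "U = {\<eta>. \<exists>d<e. \<forall>x\<in>K. cmod (pairing x \<eta> - pairing x \<xi>) \<le> d}"
  have "open U"
    unfolding open_dual_def
  proof
    fix \<eta> assume "\<eta> \<in> U"
    then obtain d where d: "d < e" "\<And>x. x \<in> K \<Longrightarrow> cmod (pairing x \<eta> - pairing x \<xi>) \<le> d"
      unfolding U_def by blast
    have "dual_nbhd K ((e - d) / 2) \<eta> \<subseteq> U"
    proof
      fix \<zeta> assume z: "\<zeta> \<in> dual_nbhd K ((e - d) / 2) \<eta>"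
      have "cmod (pairing x \<zeta> - pairing x \<xi>) \<le> (e + d) / 2" if "x \<in> K" for x
      proof -
        have "cmod (pairing x \<zeta> - pairing x \<eta>) < (e - d) / 2"
          using z that by (simp add: dual_nbhd_def)
        then show ?thesis
          using d(2)[OF that] norm_triangle_ineq[of "pairing x \<zeta> - pairing x \<eta>" "pairing x \<eta> - pairing x \<xi>"]
          by (simp add: field_simps)
      qed
      then show "\<zeta> \<in> U"
        unfolding U_def using d(1) by (auto intro!: exI[of _ "(e + d) / 2"])
    qed
    then show "\<exists>K e. compact K \<and> e > 0 \<and> dual_nbhd K e \<eta> \<subseteq> U"
      using K d(1) by (intro exI[of _ K] exI[of _ "(e - d) / 2"]) auto
  qed
  moreover have "\<xi> \<in> U" unfolding U_def using e by auto
  moreover have "U \<subseteq> dual_nbhd K e \<xi>" unfolding U_def dual_nbhd_def by force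
  ultimately show "eventually P (nhds \<xi>)"
    using P unfolding eventually_nhds by blast
qed

lemma eventually_dual_nbhd: "compact K \<Longrightarrow> e > 0 \<Longrightarrow> eventually (\<lambda>\<eta>. \<eta> \<in> dual_nbhd K e \<xi>) (nhds \<xi>)"
  unfolding eventually_nhds_dual by blast

instance dual :: (topological_ab_group_add) topological_ab_group_add
proof
  fix a b :: "'a dual"
  show "((\<lambda>x. fst x + snd x) \<longlongrightarrow> a + b) (nhds a \<times>\<^sub>F nhds b)"
    unfolding filterlim_iff
  proof (intro allI impI)
    fix P assume "eventually P (nhds (a + b))"
    then obtain K e where K: "compact K" "e > 0" and P: "\<forall>\<eta>\<in>dual_nbhd K e (a + b). P \<eta>"
      unfolding eventually_nhds_dual by blast
    have "\<xi> + \<eta> \<in> dual_nbhd K e (a + b)"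
      if \<xi>: "\<xi> \<in> dual_nbhd K (e / 2) a" and \<eta>: "\<eta> \<in> dual_nbhd K (e / 2) b" for \<xi> \<eta>
      unfolding dual_nbhd_def
    proof (intro CollectI ballI)
      fix x assume x: "x \<in> K"
      have "pairing x (\<xi> + \<eta>) - pairing x (a + b) =
          pairing x \<xi> * (pairing x \<eta> - pairing x b) + (pairing x \<xi> - pairing x a) * pairing x b"
        by (simp add: pairing_add_right algebra_simps)
      also have "cmod \<dots> \<le> cmod (pairing x \<eta> - pairing x b) + cmod (pairing x \<xi> - pairing x a)"
        by (rule order.trans[OF norm_triangle_ineq]) (simp add: norm_mult)
      also have "\<dots> < e"
        using \<xi> \<eta> x unfolding dual_nbhd_def by force
      finally show "cmod (pairing x (\<xi> + \<eta>) - pairing x (a + b)) < e" .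
    qed
    then show "eventually (\<lambda>x. P (fst x + snd x)) (nhds a \<times>\<^sub>F nhds b)"
      unfolding eventually_prod_filter using K P
      by (intro exI[of _ "\<lambda>\<xi>. \<xi> \<in> dual_nbhd K (e / 2) a"] exI[of _ "\<lambda>\<xi>. \<xi> \<in> dual_nbhd K (e / 2) b"])
        (auto intro: eventually_dual_nbhd)
  qed
  show "(uminus \<longlongrightarrow> - a) (nhds a)"
    unfolding filterlim_iff
  proof (intro allI impI)
    fix P assume "eventually P (nhds (- a))"
    then obtain K e where K: "compact K" "e > 0" and P: "\<forall>\<eta>\<in>dual_nbhd K e (- a). P \<eta>"
      unfolding eventually_nhds_dual by blast
    have "- \<xi> \<in> dual_nbhd K e (- a)" if "\<xi> \<in> dual_nbhd K e a" for \<xi>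
      using that by (simp add: dual_nbhd_def pairing_minus_right flip: complex_cnj_diff)
    with K P show "eventually (\<lambda>x. P (- x)) (nhds a)"
      unfolding eventually_nhds_dual by blast
  qed
qed

instance dual :: (topological_ab_group_add) t2_space
proof
  fix a b :: "'a dual"
  assume "a \<noteq> b"
  then obtain x where x: "pairing x a \<noteq> pairing x b"
    using dual_eqI by blast
  define e where "e = cmod (pairing x a - pairing x b) / 2"
  have e: "e > 0" using x by (simp add: e_def)
  obtain U V where U: "open U" "a \<in> U" "U \<subseteq> dual_nbhd {x} e a"
    and V: "open V" "b \<in> V" "V \<subseteq> dual_nbhd {x} e b"
    using eventually_dual_nbhd[of "{x}" e a] eventually_dual_nbhd[of "{x}" e b] e
    unfolding eventually_nhds by auto
  have "False" if "\<eta> \<in> U" "\<eta> \<in> V" for \<eta>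
  proof -
    have "cmod (pairing x \<eta> - pairing x a) < e" "cmod (pairing x \<eta> - pairing x b) < e"
      using that U V by (auto simp: dual_nbhd_def)
    then show False
      using norm_triangle_ineq4[of "pairing x \<eta> - pairing x b" "pairing x \<eta> - pairing x a"]
      by (simp add: e_def)
  qed
  then show "\<exists>U V. open U \<and> open V \<and> a \<in> U \<and> b \<in> V \<and> U \<inter> V = {}"
    using U V by blast
qed


section \<open>Subgroups, automorphisms, Haar measure\<close>

definition add_subgroup :: "'a::ab_group_add set \<Rightarrow> bool" where
  "add_subgroup H \<longleftrightarrow> 0 \<in> H \<and> (\<forall>x\<in>H. \<forall>y\<in>H. x + y \<in> H) \<and> (\<forall>x\<in>H. - x \<in> H)"

definition annihilator :: "'a::topological_ab_group_add set \<Rightarrow> 'a dual set" where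
  "annihilator H = {\<xi>. \<forall>h\<in>H. pairing h \<xi> = 1}"

definition Aut :: "('a::topological_ab_group_add \<Rightarrow> 'a) set" where
  "Aut = {A. Modules.additive A \<and> bij A \<and> homeomorphism UNIV UNIV A (inv A)}"

definition aut_power :: "('a \<Rightarrow> 'a) \<Rightarrow> int \<Rightarrow> 'a \<Rightarrow> 'a" where
  "aut_power A n = (if n \<ge> 0 then A ^^ nat n else inv A ^^ nat (- n))"

definition adjoint_aut :: "('a::topological_ab_group_add \<Rightarrow> 'a) \<Rightarrow> 'a dual \<Rightarrow> 'a dual" where
  "adjoint_aut A \<gamma> = Abs_dual (\<lambda>x. pairing (A x) \<gamma>)"

lemma pairing_adjoint:
  assumes "A \<in> Aut"
  shows "pairing x (adjoint_aut A \<gamma>) = pairing (A x) \<gamma>"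
proof -
  have "continuous_on UNIV A" "Modules.additive A"
    using assms by (auto simp: Aut_def homeomorphism_def)
  moreover from this(1) have "continuous_on UNIV (\<lambda>x. pairing (A x) \<gamma>)"
    by (rule continuous_on_compose2[OF pairing_continuous]) auto
  ultimately show ?thesis
    unfolding adjoint_aut_def by (subst pairing_Abs_dual) (auto simp: Modules.additive.add pairing_add_left)
qed

lemma inv_in_Aut:
  assumes "A \<in> Aut"
  shows "inv A \<in> Aut"
proof -
  have A: "Modules.additive A" "bij A" "homeomorphism UNIV UNIV A (inv A)"
    using assms by (auto simp: Aut_def)
  have "Modules.additive (inv A)"
  proof
    fix x y
    have "A (inv A x + inv A y) = x + y"
      using A by (simp add: Modules.additive.add bij_is_surj surj_f_inv_f)
    then show "inv A (x + y) = inv A x + inv A y"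
      using A(2) by (metis bij_inv_eq_iff)
  qed
  moreover have "homeomorphism UNIV UNIV (inv A) (inv (inv A))"
    unfolding inv_inv_eq[OF A(2)] using A(3) by (rule homeomorphism_symD)
  ultimately show ?thesis
    using bij_imp_bij_inv[OF A(2)] by (simp add: Aut_def)
qed

lemma adjoint_aut_in_Aut:
  assumes "A \<in> Aut"
  shows "adjoint_aut A \<in> Aut"
proof -
  have inv_left: "adjoint_aut (inv B) (adjoint_aut B \<gamma>) = \<gamma>" if "B \<in> Aut" for B :: "'a \<Rightarrow> 'a" and \<gamma>
    using that inv_in_Aut[OF that]
    by (intro dual_eqI) (auto simp: pairing_adjoint Aut_def bij_is_surj surj_f_inv_f)
  have invinv: "inv (inv A) = A" using assms by (auto simp: Aut_def inv_inv_eq)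
  have inv_right: "adjoint_aut A (adjoint_aut (inv A) \<gamma>) = \<gamma>" for \<gamma>
    using inv_left[OF inv_in_Aut[OF assms]] invinv by simp
  have bij: "bij (adjoint_aut A)"
    by (rule o_bij[of "adjoint_aut (inv A)"]) (auto simp: inv_left[OF assms] inv_right)
  have inv_eq: "inv (adjoint_aut A) = adjoint_aut (inv A)"
    by (rule inv_equality) (auto simp: inv_left[OF assms] inv_right)
  have cont: "continuous_on UNIV (adjoint_aut B)" if B: "B \<in> Aut" for B :: "'a \<Rightarrow> 'a"
  proof -
    have "(adjoint_aut B \<longlongrightarrow> adjoint_aut B \<gamma>) (nhds \<gamma>)" for \<gamma>
      unfolding filterlim_iff
    proof (intro allI impI)
      fix P assume "eventually P (nhds (adjoint_aut B \<gamma>))"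
      then obtain K e where K: "compact K" "e > 0" and P: "\<forall>\<eta>\<in>dual_nbhd K e (adjoint_aut B \<gamma>). P \<eta>"
        unfolding eventually_nhds_dual by blast
      have "continuous_on K B"
        using B continuous_on_subset by (auto simp: Aut_def homeomorphism_def)
      then have "compact (B ` K)" using K(1) compact_continuous_image by blast
      moreover have "adjoint_aut B \<eta> \<in> dual_nbhd K e (adjoint_aut B \<gamma>)" if "\<eta> \<in> dual_nbhd (B ` K) e \<gamma>" for \<eta>
        using that by (simp add: dual_nbhd_def pairing_adjoint[OF B])
      ultimately show "eventually (\<lambda>x. P (adjoint_aut B x)) (nhds \<gamma>)"
        using K(2) P unfolding eventually_nhds_dual by blast
    qed
    then show ?thesis
      unfolding continuous_on_def at_within_def
      by (intro ballI filterlim_mono[OF _ order_refl inf_le1])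
  qed
  have "Modules.additive (adjoint_aut A)"
    by standard (auto intro!: dual_eqI simp: pairing_adjoint[OF assms] pairing_add_right)
  moreover have "homeomorphism UNIV UNIV (adjoint_aut A) (inv (adjoint_aut A))"
    unfolding inv_eq
    by (rule homeomorphismI)
      (auto simp: cont[OF assms] cont[OF inv_in_Aut[OF assms]] inv_left[OF assms] inv_right)
  ultimately show ?thesis
    using bij by (simp add: Aut_def)
qed

definition expansive :: "('a::ab_group_add \<Rightarrow> 'a) \<Rightarrow> 'a set \<Rightarrow> bool" where
  "expansive A H \<longleftrightarrow> H \<subset> A ` H \<and> (\<Inter>n\<in>{..0::int}. aut_power A n ` H) = {0}"

definition haar_measure :: "'a::topological_ab_group_add measure \<Rightarrow> bool" where
  "haar_measure m \<longleftrightarrow>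
     sets m = sets borel \<and> emeasure m UNIV \<noteq> 0
     \<and> (\<forall>K. compact K \<longrightarrow> emeasure m K < \<infinity>)
     \<and> (\<forall>x. \<forall>B\<in>sets borel. emeasure m ((+) x ` B) = emeasure m B)
     \<and> (\<forall>B\<in>sets borel. emeasure m B = (INF U\<in>{U. open U \<and> B \<subseteq> U}. emeasure m U))
     \<and> (\<forall>U. open U \<longrightarrow> emeasure m U = (SUP K\<in>{K. compact K \<and> K \<subseteq> U}. emeasure m K))"

definition modulus :: "'a::topological_ab_group_add measure \<Rightarrow> ('a \<Rightarrow> 'a) \<Rightarrow> real" where
  "modulus m A = (THE c. c > 0 \<and> (\<forall>U\<in>sets borel. emeasure m (A ` U) = ennreal c * emeasure m U))"


section \<open>Upper density\<close>

definition Q_box ::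
  "('a::topological_ab_group_add \<Rightarrow> 'a) \<Rightarrow> 'a set \<Rightarrow> int \<Rightarrow> 'a \<times> 'a dual \<Rightarrow> ('a \<times> 'a dual) set" where
  "Q_box A H n = (\<lambda>(x, \<xi>). ((+) x ` aut_power A n ` H) \<times>
                           ((+) \<xi> ` aut_power (adjoint_aut A) n ` annihilator H))"

text \<open>
  Cardinalities are extended-valued: counting measure gives an infinite set the value
  \<open>\<infinity>\<close>, while \<open>card\<close> would give it 0.
\<close>

definition upper_density ::
  "'a::topological_ab_group_add measure \<Rightarrow> ('a \<Rightarrow> 'a) \<Rightarrow> 'a set \<Rightarrow> ('a \<times> 'a dual) set \<Rightarrow> ennreal" where
  "upper_density m A H \<Lambda> =
     limsup (\<lambda>n. ennreal (1 / modulus m A ^ (2 * n)) *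
                 (SUP z. emeasure (count_space UNIV) (\<Lambda> \<inter> Q_box A H (int n) z)))"


section \<open>Gabor systems and Bessel sequences\<close>

text \<open>
  Elements of \<open>L\<^sup>2(G)\<close> are represented by square-integrable functions; everything below is
  invariant under changes on null sets.
\<close>

definition L2 :: "'a measure \<Rightarrow> ('a \<Rightarrow> complex) set" where
  "L2 m = {f \<in> borel_measurable m. integrable m (\<lambda>x. (cmod (f x))\<^sup>2)}"

definition L2_inner :: "'a measure \<Rightarrow> ('a \<Rightarrow> complex) \<Rightarrow> ('a \<Rightarrow> complex) \<Rightarrow> complex" where
  "L2_inner m f g = (LINT x|m. f x * cnj (g x))"

definition L2_norm :: "'a measure \<Rightarrow> ('a \<Rightarrow> complex) \<Rightarrow> real" where
  "L2_norm m f = sqrt (LINT x|m. (cmod (f x))\<^sup>2)"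

definition translation :: "'a::ab_group_add \<Rightarrow> ('a \<Rightarrow> complex) \<Rightarrow> 'a \<Rightarrow> complex" where
  "translation x f = (\<lambda>y. f (y - x))"

definition modulation ::
  "'a::topological_ab_group_add dual \<Rightarrow> ('a \<Rightarrow> complex) \<Rightarrow> 'a \<Rightarrow> complex" where
  "modulation \<xi> f = (\<lambda>y. pairing y \<xi> * f y)"

definition gabor ::
  "('a::topological_ab_group_add \<Rightarrow> complex) \<Rightarrow> 'a \<times> 'a dual \<Rightarrow> 'a \<Rightarrow> complex" where
  "gabor \<phi> = (\<lambda>(x, \<xi>). modulation \<xi> (translation x \<phi>))"

definition bessel_sequence ::
  "'a measure \<Rightarrow> 'i set \<Rightarrow> ('i \<Rightarrow> 'a \<Rightarrow> complex) \<Rightarrow> bool" where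
  "bessel_sequence m I g \<longleftrightarrow>
     (\<forall>i\<in>I. g i \<in> L2 m) \<and>
     (\<exists>B>0. \<forall>f\<in>L2 m. (\<Sum>\<^sub>\<infinity>i\<in>I. ennreal ((cmod (L2_inner m f (g i)))\<^sup>2)) \<le> ennreal (B * (L2_norm m f)\<^sup>2))"

end

theory Submission
  imports Defs
begin

text \<open>
  Write \<open>K\<^sub>n = A\<^sup>-\<^sup>nH\<close> and let \<open>\<Delta>\<close> be the modulus of \<open>A\<close>. The proof bounds the number of
  points of \<open>\<Lambda>\<close> in a box \<open>Q\<^sub>n(x0, \<xi>0)\<close> by testing the Bessel inequality on the functions
  \<open>f\<^sub>c(y) = \<langle>y, \<xi>0\<rangle> 1\<^sub>c(y)\<close>, where \<open>c\<close> runs through cosets of \<open>K\<^sub>n\<close>.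

  If \<open>(x, \<xi>)\<close> lies in the box, then \<open>\<xi> - \<xi>0\<close> is trivial on \<open>K\<^sub>n\<close>, so the inner product of \<open>f\<^sub>c\<close> with
  \<open>M\<^sub>\<xi> T\<^sub>x \<phi>\<close> is, up to a unimodular factor and a conjugation, the integral of \<open>\<phi>\<close> over the
  coset \<open>c - x\<close> (\<open>inner_modulated_indicator_gabor\<close>). Frequencies have disappeared, and \<open>x\<close> only
  permutes cosets.

  Some coset \<open>p + K\<^sub>k\<close> carries a nonzero integral \<open>I\<close> of \<open>\<phi>\<close>: the cosets of the \<open>K\<^sub>n\<close> generate
  the topology, so by regularity of Haar measure a square integrable function whose integrals over all of
  them vanish is zero almost everywhere (\<open>exists_coset_integral_nonzero\<close>). For \<open>n \<ge> k\<close> split \<open>p + K\<^sub>k\<close>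
  into its \<open>\<Delta>\<^sup>n m(K\<^sub>k)\<close> cosets of \<open>K\<^sub>n\<close>. By the Cauchy--Schwarz inequality their integrals have square
  sum at least \<open>|I|\<^sup>2 / (\<Delta>\<^sup>n m(K\<^sub>k))\<close>. Every point of \<open>\<Lambda>\<close> in the box thus contributes at
  least this much to the sum of \<open>|\<langle>f\<^sub>c, M\<^sub>\<xi> T\<^sub>x \<phi>\<rangle>|\<^sup>2\<close> over the points and over the cosets \<open>c\<close>
  in \<open>x0 + p + A\<^sup>nH\<close>. By the Bessel inequality with bound \<open>B\<close> the sum is at most
  \<open>B\<close> times the total squared norm \<open>m(A\<^sup>nH) = \<Delta>\<^sup>n\<close> of the \<open>f\<^sub>c\<close>. Hence the box contains at most
  \<open>B m(K\<^sub>k) \<Delta>\<^sup>2\<^sup>n / |I|\<^sup>2\<close> points (\<open>card_box_le\<close>), and the density is at most \<open>B m(K\<^sub>k) / |I|\<^sup>2\<close>.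

  The argument uses \<open>m(A\<^sup>nH) = \<Delta>\<^sup>n\<close>, and therefore that \<open>A\<close> scales the measure of all Borel
  sets by one factor. This is checked on cosets by counting and extended by regularity
  (\<open>emeasure_A_borel\<close>), the tool being \<open>compact_open_interpolation\<close>.
\<close>


section \<open>Cosets of open subgroups\<close>

definition cosets :: "'a::ab_group_add set \<Rightarrow> 'a set \<Rightarrow> 'a set set" where
  "cosets K S = (\<lambda>p. (+) p ` K) ` S"

lemma mem_translate_iff: "y \<in> (+) p ` K \<longleftrightarrow> y - p \<in> K" for p :: "'a::ab_group_add"
  by (force simp: image_iff)

lemma translate_translate: "(+) p ` (+) q ` K = (+) (p + q) ` K" for p :: "'a::ab_group_add"
  by (auto simp: mem_translate_iff algebra_simps)

lemma add_subgroup_diff: "add_subgroup K \<Longrightarrow> x \<in> K \<Longrightarrow> y \<in> K \<Longrightarrow> x - y \<in> K"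
  unfolding add_subgroup_def by (metis add_uminus_conv_diff)

lemma coset_self: "add_subgroup K \<Longrightarrow> p \<in> (+) p ` K"
  by (simp add: mem_translate_iff add_subgroup_def)

lemma coset_eqI:
  assumes K: "add_subgroup K" and p: "p \<in> (+) q ` K"
  shows "(+) p ` K = (+) q ` K"
proof -
  have "x - p \<in> K \<longleftrightarrow> x - q \<in> K" for x
  proof
    assume "x - p \<in> K"
    then have "(x - p) + (p - q) \<in> K"
      using K p unfolding add_subgroup_def mem_translate_iff by blast
    then show "x - q \<in> K" by simp
  next
    assume "x - q \<in> K"
    then have "(x - q) - (p - q) \<in> K"
      using add_subgroup_diff[OF K] p unfolding mem_translate_iff by blast
    then show "x - p \<in> K" by simp
  qed
  then show ?thesis by (intro set_eqI) (simp only: mem_translate_iff)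
qed

lemma disjoint_cosets:
  assumes K: "add_subgroup K"
  shows "disjoint_family_on (\<lambda>c. c) (cosets K S)"
  unfolding disjoint_family_on_def cosets_def
  using coset_eqI[OF K] by blast

lemma Union_cosets:
  assumes "add_subgroup K" and "\<And>s k. s \<in> S \<Longrightarrow> k \<in> K \<Longrightarrow> s + k \<in> S"
  shows "\<Union> (cosets K S) = S"
  using assms coset_self[OF assms(1)] by (auto simp: cosets_def)

lemma open_translate:
  fixes p :: "'a::topological_ab_group_add"
  assumes "open U"
  shows "open ((+) p ` U)"
proof -
  have "continuous_on UNIV (\<lambda>x. x - p)" by (intro continuous_intros)
  with assms have "open ((\<lambda>x. x - p) -` U)"
    by (rule open_vimage)
  moreover have "(\<lambda>x. x - p) -` U = (+) p ` U" by (auto simp: mem_translate_iff)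
  ultimately show ?thesis by simp
qed

lemma compact_translate:
  fixes p :: "'a::topological_ab_group_add"
  shows "compact C \<Longrightarrow> compact ((+) p ` C)"
  by (intro compact_continuous_image continuous_intros)

text \<open>
  Cosets of an open subgroup form an open cover, and a coset meeting another one equals it; so a
  finite subcover of a compact set already contains every coset that meets the set.
\<close>

lemma finite_cosets:
  fixes K :: "'a::topological_ab_group_add set"
  assumes K: "add_subgroup K" and op: "open K" and S: "compact S"
  shows "finite (cosets K S)"
proof -
  have "S \<subseteq> (\<Union>p\<in>S. (+) p ` K)" using coset_self[OF K] by blast
  then obtain D where D: "D \<subseteq> S" "finite D" "S \<subseteq> (\<Union>p\<in>D. (+) p ` K)"
    using compactE_image[OF S, of S "\<lambda>p. (+) p ` K"] open_translate[OF op] by blast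
  have "cosets K S \<subseteq> (\<lambda>p. (+) p ` K) ` D"
    using D(3) coset_eqI[OF K] unfolding cosets_def by blast
  then show ?thesis using D(2) finite_surj by blast
qed


section \<open>Powers of an automorphism\<close>

lemma id_in_Aut: "id \<in> Aut"
  unfolding Aut_def
  by (auto simp: Modules.additive_def homeomorphism_def)

lemma comp_in_Aut:
  assumes "B \<in> Aut" "C \<in> Aut"
  shows "B \<circ> C \<in> Aut"
proof -
  have B: "Modules.additive B" "bij B" "homeomorphism UNIV UNIV B (inv B)"
    and C: "Modules.additive C" "bij C" "homeomorphism UNIV UNIV C (inv C)"
    using assms by (auto simp: Aut_def)
  have "homeomorphism UNIV UNIV (B \<circ> C) (inv (B \<circ> C))"
    unfolding o_inv_distrib[OF B(2) C(2)]
    by (rule homeomorphism_compose[OF C(3) B(3)])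
  then show ?thesis
    using B C by (auto simp: Aut_def Modules.additive_def bij_comp)
qed

lemma funpow_in_Aut: "B \<in> Aut \<Longrightarrow> B ^^ n \<in> Aut"
  by (induction n) (auto intro: comp_in_Aut id_in_Aut simp: id_def[symmetric])

lemma Aut_add: "B \<in> Aut \<Longrightarrow> B (x + y) = B x + B y"
  by (simp add: Aut_def Modules.additive_def)

lemma Aut_image_open: "B \<in> Aut \<Longrightarrow> open U \<Longrightarrow> open (B ` U)"
  using homeomorphism_imp_open_map[of UNIV UNIV B "inv B" U] by (simp add: Aut_def)

lemma Aut_image_compact: "B \<in> Aut \<Longrightarrow> compact C \<Longrightarrow> compact (B ` C)"
  by (rule compact_continuous_image)
    (auto simp: Aut_def homeomorphism_def intro: continuous_on_subset)

lemma Aut_image_subgroup: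
  assumes B: "B \<in> Aut" and K: "add_subgroup K"
  shows "add_subgroup (B ` K)"
proof -
  interpret Modules.additive B using B by (simp add: Aut_def)
  show ?thesis
    using K unfolding add_subgroup_def
    by (auto simp flip: add minus intro!: imageI) (metis zero imageI)
qed

lemma Aut_image_inv: "B \<in> Aut \<Longrightarrow> B ` inv B ` S = S"
  by (auto simp: Aut_def image_image bij_is_surj surj_f_inv_f)

lemma Aut_inv_image: "B \<in> Aut \<Longrightarrow> inv B ` B ` S = S"
  by (auto simp: Aut_def image_image bij_is_inj)


section \<open>Haar measure\<close>

lemma Aut_image_borel:
  assumes B: "B \<in> Aut" and U: "U \<in> sets borel"
  shows "B ` U \<in> sets borel"
proof -
  have "continuous_on UNIV (inv B)"
    using B by (auto simp: Aut_def homeomorphism_def)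
  then have "inv B \<in> borel_measurable borel" by (rule borel_measurable_continuous_onI)
  then have "inv B -` U \<inter> space borel \<in> sets borel" using U by (rule measurable_sets)
  moreover have "inv B -` U = B ` U"
    using B by (simp add: Aut_def bij_vimage_eq_inv_image bij_imp_bij_inv inv_inv_eq)
  ultimately show ?thesis by simp
qed

locale haar =
  fixes m :: "'a::{topological_ab_group_add, t2_space} measure"
  assumes haar: "haar_measure m"
begin

lemma sets_haar [measurable_cong, simp]: "sets m = sets borel"
  using haar by (simp add: haar_measure_def)

lemma space_haar [simp]: "space m = UNIV"
  using sets_eq_imp_space_eq[OF sets_haar] by simp

lemma emeasure_compact: "compact C \<Longrightarrow> emeasure m C < \<infinity>"
  using haar by (simp add: haar_measure_def)

lemma emeasure_translate: "B \<in> sets borel \<Longrightarrow> emeasure m ((+) x ` B) = emeasure m B"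
  using haar by (simp add: haar_measure_def)

lemma outer_regular:
  "B \<in> sets borel \<Longrightarrow> emeasure m B = (INF U\<in>{U. open U \<and> B \<subseteq> U}. emeasure m U)"
  using haar unfolding haar_measure_def by blast

lemma inner_regular:
  "open U \<Longrightarrow> emeasure m U = (SUP K\<in>{K. compact K \<and> K \<subseteq> U}. emeasure m K)"
  using haar unfolding haar_measure_def by blast

lemma emeasure_finite_cosets:
  assumes "add_subgroup K" "open K" "compact K" "finite (cosets K S)"
  shows "emeasure m (\<Union> (cosets K S)) = of_nat (card (cosets K S)) * emeasure m K"
proof -
  have "(\<lambda>c. c) ` cosets K S \<subseteq> sets m"
    using assms(2) by (auto simp: cosets_def intro!: borel_open open_translate)
  from sum_emeasure[OF this disjoint_cosets[OF assms(1)] assms(4)]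
  have "emeasure m (\<Union> (cosets K S)) = (\<Sum>c\<in>cosets K S. emeasure m c)"
    by simp
  also have "\<dots> = (\<Sum>c\<in>cosets K S. emeasure m K)"
    by (rule sum.cong) (auto simp: cosets_def emeasure_translate borel_open assms)
  finally show ?thesis by simp
qed

lemma integral_translate:
  fixes f :: "'a \<Rightarrow> complex"
  assumes f: "f \<in> borel_measurable borel"
  shows "(LINT y|m. f (y - x)) = (LINT y|m. f y)"
proof -
  have meas: "(\<lambda>y. y - x) \<in> measurable m m"
    unfolding measurable_cong_sets[OF sets_haar sets_haar]
    by (intro borel_measurable_continuous_onI continuous_intros)
  have "distr m m (\<lambda>y. y - x) = m"
  proof (rule measure_eqI)
    fix S assume "S \<in> sets (distr m m (\<lambda>y. y - x))"
    then have S: "S \<in> sets borel" by simp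
    have "emeasure (distr m m (\<lambda>y. y - x)) S = emeasure m ((\<lambda>y. y - x) -` S)"
      using meas S by (simp add: emeasure_distr)
    also have "(\<lambda>y. y - x) -` S = (+) x ` S" by (auto simp: mem_translate_iff)
    finally show "emeasure (distr m m (\<lambda>y. y - x)) S = emeasure m S"
      using S by (simp add: emeasure_translate)
  qed simp
  moreover have "(LINT y|distr m m (\<lambda>y. y - x). f y) = (LINT y|m. f (y - x))"
    using meas f by (intro integral_distr) (auto cong: measurable_cong_sets)
  ultimately show ?thesis by simp
qed

lemma set_integral_translate:
  fixes f :: "'a \<Rightarrow> complex"
  assumes f: "f \<in> borel_measurable borel" and S: "S \<in> sets borel"
  shows "(LINT y:(+) x ` S|m. f (y - x)) = (LINT y:S|m. f y)"
proof -
  have "indicator ((+) x ` S) y = (indicator S (y - x) :: real)" for y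
    by (auto simp: indicator_def mem_translate_iff)
  then have "(LINT y:(+) x ` S|m. f (y - x)) = (LINT y|m. indicator S (y - x) *\<^sub>R f (y - x))"
    by (simp add: set_lebesgue_integral_def)
  also have "\<dots> = (LINT y:S|m. f y)"
    unfolding set_lebesgue_integral_def
    by (rule integral_translate[of "\<lambda>y. indicator S y *\<^sub>R f y"]) (use f S in measurable)
  finally show ?thesis .
qed

lemma borel_measurable_haar [simp]: "borel_measurable m = borel_measurable borel"
  by (rule measurable_cong_sets) simp_all

text \<open>
  Bochner integrals of non-integrable functions are \<open>0\<close> by default. This lemma makes the
  integrals of square integrable functions over compact cosets additive.
\<close>

lemma L2_set_integrable:
  fixes f :: "'a \<Rightarrow> 'b::{banach, second_countable_topology}"
  assumes f: "f \<in> borel_measurable borel" and f2: "integrable m (\<lambda>x. (norm (f x))\<^sup>2)"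
    and S: "S \<in> sets borel" "emeasure m S < \<infinity>"
  shows "set_integrable m S f"
  unfolding set_integrable_def
proof (rule Bochner_Integration.integrable_bound)
  show "integrable m (\<lambda>x. indicator S x + (norm (f x))\<^sup>2)"
    using S f2 by (intro Bochner_Integration.integrable_add integrable_real_indicator) auto
  show "(\<lambda>x. indicator S x *\<^sub>R f x) \<in> borel_measurable m"
    using f S(1) by measurable
  have "t \<le> 1 + t\<^sup>2" for t :: real
    using zero_le_power2[of "t - 1 / 2"] by (simp add: power2_eq_square algebra_simps)
  then show "AE x in m. norm (indicator S x *\<^sub>R f x) \<le> norm (indicator S x + (norm (f x))\<^sup>2)"
    by (intro AE_I2) (auto simp: indicator_def)
qed

lemma measure_finite_cosets:
  assumes "add_subgroup K" "open K" "compact K" "finite (cosets K S)"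
  shows "measure m (\<Union> (cosets K S)) = real (card (cosets K S)) * measure m K"
  by (simp add: measure_def emeasure_finite_cosets[OF assms] enn2real_mult)

end


section \<open>The scale of compact open subgroups\<close>

locale expansive_aut = haar m
  for m :: "'a::{topological_ab_group_add, t2_space} measure" +
  fixes H :: "'a set" and A :: "'a \<Rightarrow> 'a"
  assumes H_subgroup: "add_subgroup H" and H_compact: "compact H" and H_open: "open H"
    and H_normalized: "emeasure m H = 1"
    and A_Aut: "A \<in> Aut" and A_expansive: "expansive A H"
begin

text \<open>
  The sets \<open>A\<^sup>-\<^sup>nH\<close> shrink to \<open>{0}\<close> and serve as a neighbourhood base of \<open>0\<close>; the
  sets \<open>A\<^sup>nH\<close> are the spatial sides of the boxes that define the density. Natural number exponents
  for both avoid case distinctions on integer powers.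
\<close>

definition level :: "nat \<Rightarrow> 'a set" where
  "level n = (inv A ^^ n) ` H"

definition dilated :: "nat \<Rightarrow> 'a set" where
  "dilated n = (A ^^ n) ` H"

lemma
  level_subgroup: "add_subgroup (level n)" and
  level_open: "open (level n)" and
  level_compact: "compact (level n)"
  unfolding level_def
  by (intro Aut_image_subgroup Aut_image_open Aut_image_compact funpow_in_Aut inv_in_Aut
      A_Aut H_subgroup H_open H_compact)+

lemma
  dilated_subgroup: "add_subgroup (dilated n)" and
  dilated_open: "open (dilated n)" and
  dilated_compact: "compact (dilated n)"
  unfolding dilated_def
  by (intro Aut_image_subgroup Aut_image_open Aut_image_compact funpow_in_Aut
      A_Aut H_subgroup H_open H_compact)+

lemma H_subset: "H \<subseteq> A ` H"
  using A_expansive by (auto simp: expansive_def)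

lemma level_Suc_subset: "level (Suc n) \<subseteq> level n"
proof -
  have "(inv A ^^ Suc n) ` H \<subseteq> (inv A ^^ Suc n) ` A ` H"
    using H_subset by (rule image_mono)
  also have "\<dots> = (inv A ^^ n) ` inv A ` A ` H"
    unfolding funpow_Suc_right by (simp add: image_comp)
  also have "\<dots> = (inv A ^^ n) ` H" by (simp only: Aut_inv_image[OF A_Aut])
  finally show ?thesis by (simp only: level_def)
qed

lemma level_antimono: "j \<le> k \<Longrightarrow> level k \<subseteq> level j"
  using level_Suc_subset by (rule lift_Suc_antimono_le)

lemma H_subset_dilated: "H \<subseteq> dilated n"
proof (induction n)
  case (Suc n)
  have "H \<subseteq> A ` H" by (rule H_subset)
  also have "\<dots> \<subseteq> A ` dilated n" using Suc by (rule image_mono)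
  finally show ?case by (simp add: dilated_def image_comp)
qed (simp add: dilated_def)

lemma level_subset_dilated: "level k \<subseteq> dilated n"
  using level_antimono[of 0 k] H_subset_dilated[of n] by (auto simp: level_def)

lemma Inter_level: "(\<Inter>n. level n) = {0}"
proof -
  have "(\<Inter>n. level n) = (\<Inter>n\<in>{..0::int}. aut_power A n ` H)"
  proof (intro equalityI subsetI)
    fix x assume x: "x \<in> (\<Inter>n. level n)"
    have "x \<in> aut_power A n ` H" if "n \<le> 0" for n
    proof -
      have "aut_power A n = inv A ^^ nat (- n)"
        using that by (auto simp: aut_power_def)
      with x show ?thesis by (auto simp: level_def)
    qed
    then show "x \<in> (\<Inter>n\<in>{..0::int}. aut_power A n ` H)" by blast
  next
    fix x assume x: "x \<in> (\<Inter>n\<in>{..0::int}. aut_power A n ` H)"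
    have "x \<in> level n" for n
    proof -
      have "aut_power A (- int n) = inv A ^^ n" by (auto simp: aut_power_def)
      moreover have "x \<in> aut_power A (- int n) ` H" using x by (rule INT_D) simp
      ultimately show ?thesis by (simp add: level_def)
    qed
    then show "x \<in> (\<Inter>n. level n)" by blast
  qed
  then show ?thesis using A_expansive by (simp add: expansive_def)
qed

text \<open>
  The compact part of \<open>H\<close> outside an open neighbourhood of \<open>0\<close> is covered by the increasing open
  complements of the levels, because the levels intersect in \<open>{0}\<close>. Finitely many of
  them suffice, hence one does.
\<close>

lemma level_subset_nhd:
  assumes U: "open U" and p: "p \<in> U"
  shows "\<exists>n. (+) p ` level n \<subseteq> U"
proof -
  define V where "V = (+) (- p) ` U"
  have V: "open V" "0 \<in> V"
    using open_translate[OF U, of "- p"] p unfolding V_def mem_translate_iff by simp_all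
  have "\<exists>n. level n \<subseteq> V"
  proof -
    have "H - V \<subseteq> (\<Union>n. - level n)" using Inter_level V(2) by auto
    moreover have "compact (H - V)" using H_compact V(1) by (rule compact_diff)
    ultimately obtain D where D: "finite D" "H - V \<subseteq> (\<Union>n\<in>D. - level n)"
      using compactE_image[of "H - V" UNIV "\<lambda>n. - level n"]
      by (metis level_compact compact_imp_closed open_Compl)
    obtain N where N: "\<And>n. n \<in> D \<Longrightarrow> n \<le> N"
      using D(1) by (meson finite_nat_set_iff_bounded_le)
    have "level N \<subseteq> V"
      using D(2) level_antimono[OF N] level_antimono[of 0 N] by (fastforce simp: level_def[of 0])
    then show ?thesis by blast
  qed
  then obtain n where "level n \<subseteq> V" by blast
  then have "(+) p ` level n \<subseteq> (+) p ` V" by (rule image_mono)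
  also have "(+) p ` V = U" unfolding V_def translate_translate by simp
  finally show ?thesis ..
qed

text \<open>
  This is the topological fact behind every regularity argument below: between a compact set and an
  open set containing it fits a finite union of cosets of a single level. A priori the level depends on
  the point; compactness leaves finitely many levels, and passing to the deepest only
  shrinks the cosets.
\<close>

lemma compact_open_interpolation:
  assumes C: "compact C" and U: "open U" and CU: "C \<subseteq> U"
  obtains n where "C \<subseteq> \<Union> (cosets (level n) C)" "\<Union> (cosets (level n) C) \<subseteq> U"
proof -
  have "\<forall>p\<in>C. \<exists>n. (+) p ` level n \<subseteq> U"
    using level_subset_nhd[OF U] CU by blast
  then obtain N where N: "\<And>p. p \<in> C \<Longrightarrow> (+) p ` level (N p) \<subseteq> U" by metis
  have "C \<subseteq> (\<Union>p\<in>C. (+) p ` level (N p))" using coset_self[OF level_subgroup] by blast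
  then obtain D where D: "D \<subseteq> C" "finite D" "C \<subseteq> (\<Union>p\<in>D. (+) p ` level (N p))"
    using compactE_image[OF C, of C "\<lambda>p. (+) p ` level (N p)"] open_translate[OF level_open]
    by blast
  obtain M where M: "\<And>p. p \<in> D \<Longrightarrow> N p \<le> M"
    using finite_imageI[OF D(2), of N] by (meson finite_nat_set_iff_bounded_le imageI)
  have "(+) q ` level M \<subseteq> U" if q: "q \<in> C" for q
  proof -
    obtain p where p: "p \<in> D" "q \<in> (+) p ` level (N p)" using D(3) q by blast
    have "(+) q ` level M \<subseteq> (+) q ` level (N p)"
      using level_antimono[OF M[OF p(1)]] by (rule image_mono)
    also have "\<dots> = (+) p ` level (N p)" using coset_eqI[OF level_subgroup p(2)] .
    also have "\<dots> \<subseteq> U" using N p(1) D(1) by blast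
    finally show ?thesis .
  qed
  then show ?thesis
    using coset_self[OF level_subgroup, of _ M] by (intro that[of M]) (auto simp: cosets_def)
qed


section \<open>The modulus\<close>

text \<open>
  As \<open>A\<close> is injective and additive, it maps the cosets of a level bijectively to the cosets
  of the image subgroup, which all have the same measure.
\<close>

lemma emeasure_A_Union_cosets:
  assumes C: "compact C"
  shows "emeasure m (A ` \<Union> (cosets (level n) C))
    = of_nat (card (cosets (level n) C)) * emeasure m (A ` level n)"
proof -
  let ?C = "cosets (level n) C" and ?D = "cosets (A ` level n) (A ` C)"
  have D_eq: "?D = (\<lambda>c. A ` c) ` ?C"
    by (auto simp: cosets_def image_image Aut_add[OF A_Aut])
  have fin: "finite ?C" by (rule finite_cosets[OF level_subgroup level_open C])
  have inj: "inj A" using A_Aut by (simp add: Aut_def bij_is_inj)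
  have card: "card ?D = card ?C"
    unfolding D_eq by (rule card_image) (meson inj inj_image_eq_iff inj_onI)
  have UD: "\<Union> ?D = A ` \<Union> ?C" unfolding D_eq by blast
  have "emeasure m (\<Union> ?D) = of_nat (card ?D) * emeasure m (A ` level n)"
    by (intro emeasure_finite_cosets)
      (use fin in \<open>simp_all add: Aut_image_subgroup Aut_image_open Aut_image_compact A_Aut
        level_subgroup level_open level_compact D_eq\<close>)
  then show ?thesis by (simp only: UD card)
qed

text \<open>
  Both \<open>H\<close> and \<open>A H\<close> split into the same number of cosets, of \<open>level n\<close> and of \<open>A (level n)\<close>
  respectively, so the two ratios of measures agree.
\<close>

lemma emeasure_A_level:
  "emeasure m (A ` level n) = emeasure m (A ` H) * emeasure m (level n)"
proof -
  let ?C = "cosets (level n) H"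
  have UC: "\<Union> ?C = H"
    using level_antimono[of 0 n] H_subgroup
    by (intro Union_cosets level_subgroup) (auto simp: level_def[of 0] add_subgroup_def)
  have H1: "1 = of_nat (card ?C) * emeasure m (level n)"
    using emeasure_finite_cosets[OF level_subgroup[of n] level_open level_compact
        finite_cosets[OF level_subgroup level_open H_compact]]
    by (simp only: UC H_normalized)
  have "emeasure m (A ` H) * emeasure m (level n)
      = emeasure m (A ` level n) * (of_nat (card ?C) * emeasure m (level n))"
    using emeasure_A_Union_cosets[OF H_compact, of n] by (simp only: UC) (simp add: mult_ac)
  then show ?thesis by (simp flip: H1)
qed

lemma emeasure_A_cosets:
  assumes "compact C"
  shows "emeasure m (A ` \<Union> (cosets (level n) C))
    = emeasure m (A ` H) * emeasure m (\<Union> (cosets (level n) C))"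
  using emeasure_finite_cosets[OF level_subgroup level_open level_compact
      finite_cosets[OF level_subgroup level_open assms]]
  by (simp only: emeasure_A_Union_cosets[OF assms] emeasure_A_level) (simp add: mult_ac)

text \<open>
  Scaling passes from finite unions of cosets to open sets by inner regularity: a
  compact subset of the open set can be enlarged to a finite union of cosets inside it. For the upper
  estimate the same is done with the preimage of a compact subset of \<open>A U\<close>.
\<close>

lemma emeasure_A_open:
  assumes U: "open U"
  shows "emeasure m (A ` U) = emeasure m (A ` H) * emeasure m U"
proof (rule antisym)
  let ?c = "emeasure m (A ` H)"
  have AU: "open (A ` U)" using Aut_image_open[OF A_Aut U] .
  show "emeasure m (A ` U) \<le> ?c * emeasure m U"
    unfolding inner_regular[OF AU]
  proof (rule SUP_least)
    fix K assume "K \<in> {K. compact K \<and> K \<subseteq> A ` U}"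
    then have K: "compact K" "K \<subseteq> A ` U" by auto
    define C where "C = inv A ` K"
    have C: "compact C" "A ` C = K" "C \<subseteq> U"
      using K Aut_image_compact[OF inv_in_Aut[OF A_Aut]] Aut_image_inv[OF A_Aut]
        image_mono[OF K(2), of "inv A"]
      by (auto simp: C_def Aut_inv_image[OF A_Aut])
    obtain n where n: "C \<subseteq> \<Union> (cosets (level n) C)" "\<Union> (cosets (level n) C) \<subseteq> U"
      by (rule compact_open_interpolation[OF C(1) U C(3)])
    have op: "open (\<Union> (cosets (level n) C))"
      by (auto simp: cosets_def intro!: open_translate level_open)
    have "emeasure m K \<le> emeasure m (A ` \<Union> (cosets (level n) C))"
      using n(1) C(2) Aut_image_open[OF A_Aut op]
      by (intro emeasure_mono) (auto simp: borel_open)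
    also have "\<dots> = ?c * emeasure m (\<Union> (cosets (level n) C))"
      by (rule emeasure_A_cosets[OF C(1)])
    also have "\<dots> \<le> ?c * emeasure m U"
      using n(2) U by (intro mult_left_mono emeasure_mono) auto
    finally show "emeasure m K \<le> ?c * emeasure m U" .
  qed
  have "?c * emeasure m U = (SUP K\<in>{K. compact K \<and> K \<subseteq> U}. ?c * emeasure m K)"
    unfolding inner_regular[OF U] by (rule SUP_mult_left_ennreal)
  also have "\<dots> \<le> emeasure m (A ` U)"
  proof (rule SUP_least)
    fix C assume "C \<in> {K. compact K \<and> K \<subseteq> U}"
    then have C: "compact C" "C \<subseteq> U" by auto
    obtain n where n: "C \<subseteq> \<Union> (cosets (level n) C)" "\<Union> (cosets (level n) C) \<subseteq> U"
      by (rule compact_open_interpolation[OF C(1) U C(2)])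
    have op: "open (\<Union> (cosets (level n) C))"
      by (auto simp: cosets_def intro!: open_translate level_open)
    have "?c * emeasure m C \<le> ?c * emeasure m (\<Union> (cosets (level n) C))"
      using n(1) op by (intro mult_left_mono emeasure_mono) auto
    also have "\<dots> = emeasure m (A ` \<Union> (cosets (level n) C))"
      by (rule emeasure_A_cosets[OF C(1), symmetric])
    also have "\<dots> \<le> emeasure m (A ` U)"
      using n(2) AU by (intro emeasure_mono) (auto simp: borel_open)
    finally show "?c * emeasure m C \<le> emeasure m (A ` U)" .
  qed
  finally show "?c * emeasure m U \<le> emeasure m (A ` U)" .
qed

lemma emeasure_AH_bounds: "1 \<le> emeasure m (A ` H)" "emeasure m (A ` H) < \<infinity>"
proof -
  have "emeasure m H \<le> emeasure m (A ` H)"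
    using H_subset Aut_image_open[OF A_Aut H_open] by (intro emeasure_mono) auto
  then show "1 \<le> emeasure m (A ` H)" by (simp add: H_normalized)
  show "emeasure m (A ` H) < \<infinity>"
    by (rule emeasure_compact[OF Aut_image_compact[OF A_Aut H_compact]])
qed

text \<open>
  Outer regularity applies to both sides, as \<open>A\<close> induces a bijection between the open sets
  containing \<open>B\<close> and those containing \<open>A B\<close>.
\<close>

lemma emeasure_A_borel:
  assumes B: "B \<in> sets borel"
  shows "emeasure m (A ` B) = emeasure m (A ` H) * emeasure m B"
proof (rule antisym)
  let ?c = "emeasure m (A ` H)"
  have AB: "A ` B \<in> sets borel" by (rule Aut_image_borel[OF A_Aut B])
  have c: "?c \<noteq> 0" "?c \<noteq> top"
    using emeasure_AH_bounds by auto
  have "emeasure m (A ` B) / ?c \<le> (INF U\<in>{U. open U \<and> B \<subseteq> U}. emeasure m U)"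
  proof (rule INF_greatest)
    fix U assume "U \<in> {U. open U \<and> B \<subseteq> U}"
    then have U: "open U" "B \<subseteq> U" by auto
    have "emeasure m (A ` B) \<le> emeasure m (A ` U)"
      using U Aut_image_open[OF A_Aut U(1)] by (intro emeasure_mono) auto
    then show "emeasure m (A ` B) / ?c \<le> emeasure m U"
      using c by (intro divide_le_posI_ennreal)
        (auto simp: emeasure_A_open[OF U(1)] mult.commute zero_less_iff_neq_zero)
  qed
  then have "emeasure m (A ` B) / ?c \<le> emeasure m B" using outer_regular[OF B] by simp
  moreover have eq: "?c * (emeasure m (A ` B) / ?c) = emeasure m (A ` B)"
    using c by (subst mult.commute) (simp add: ennreal_divide_times ennreal_divide_self less_top)
  ultimately have "?c * (emeasure m (A ` B) / ?c) \<le> ?c * emeasure m B"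
    by (intro mult_left_mono) auto
  then show "emeasure m (A ` B) \<le> ?c * emeasure m B"
    by (simp only: eq)
  show "?c * emeasure m B \<le> emeasure m (A ` B)"
    unfolding outer_regular[OF AB]
  proof (rule INF_greatest)
    fix V assume "V \<in> {U. open U \<and> A ` B \<subseteq> U}"
    then have V: "open V" "A ` B \<subseteq> V" by auto
    have U: "open (inv A ` V)" "B \<subseteq> inv A ` V" "A ` inv A ` V = V"
      using V Aut_image_open[OF inv_in_Aut[OF A_Aut]] Aut_image_inv[OF A_Aut]
        image_mono[OF V(2), of "inv A"]
      by (auto simp: Aut_inv_image[OF A_Aut])
    have "?c * emeasure m B \<le> ?c * emeasure m (inv A ` V)"
      using U by (intro mult_left_mono emeasure_mono) auto
    then show "?c * emeasure m B \<le> emeasure m V"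
      using emeasure_A_open[OF U(1)] U(3) by simp
  qed
qed

abbreviation modulus_A :: real ("\<Delta>") where
  "\<Delta> \<equiv> modulus m A"

text \<open>
  The modulus is a definite description, so its existence is needed. It is
  usually a consequence of the uniqueness of Haar measure; here the scaling law holds for Borel sets by
  \<open>emeasure_A_borel\<close>, and evaluating it at \<open>H\<close> identifies the factor.
\<close>

lemma modulus_eq: "\<Delta> = enn2real (emeasure m (A ` H))"
  unfolding modulus_def
proof (rule the_equality)
  let ?c = "enn2real (emeasure m (A ` H))"
  have c: "ennreal ?c = emeasure m (A ` H)"
    using emeasure_AH_bounds by (simp add: less_top)
  have "?c > 0"
    using emeasure_AH_bounds less_le_trans[OF zero_less_one emeasure_AH_bounds(1)]
    by (auto simp: enn2real_positive_iff less_top)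
  then show "?c > 0 \<and> (\<forall>U\<in>sets borel. emeasure m (A ` U) = ennreal ?c * emeasure m U)"
    using emeasure_A_borel c by simp
next
  fix c :: real
  assume "c > 0 \<and> (\<forall>U\<in>sets borel. emeasure m (A ` U) = ennreal c * emeasure m U)"
  then have "c > 0" "emeasure m (A ` H) = ennreal c"
    using H_open H_normalized by auto
  then show "c = enn2real (emeasure m (A ` H))" by simp
qed

lemma emeasure_A: "B \<in> sets borel \<Longrightarrow> emeasure m (A ` B) = ennreal \<Delta> * emeasure m B"
  using emeasure_AH_bounds by (simp add: emeasure_A_borel modulus_eq less_top)

lemma modulus_ge_1: "1 \<le> \<Delta>"
proof -
  have "ennreal 1 \<le> ennreal \<Delta>"
    using emeasure_AH_bounds by (simp add: modulus_eq less_top)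
  then show ?thesis by (subst (asm) ennreal_le_iff) (auto simp: modulus_eq)
qed

lemma measure_dilated: "measure m (dilated n) = \<Delta> ^ n"
proof -
  have "emeasure m (dilated n) = ennreal (\<Delta> ^ n)"
  proof (induction n)
    case 0
    then show ?case by (simp add: dilated_def H_normalized)
  next
    case (Suc n)
    have "dilated (Suc n) = A ` dilated n" by (simp add: dilated_def image_comp)
    then show ?case
      using Suc modulus_ge_1 by (simp add: emeasure_A borel_open dilated_open ennreal_mult)
  qed
  then show ?thesis using modulus_ge_1 by (simp add: measure_def)
qed

lemma measure_level: "measure m (level n) = 1 / \<Delta> ^ n"
proof (induction n)
  case 0
  then show ?case by (simp add: level_def measure_def H_normalized)
next
  case (Suc n)
  have "level (Suc n) = inv A ` level n" by (simp add: level_def image_comp)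
  then have "level n = A ` level (Suc n)" by (simp add: Aut_image_inv[OF A_Aut])
  then have "measure m (level n) = \<Delta> * measure m (level (Suc n))"
    using modulus_ge_1 by (simp add: measure_def emeasure_A borel_open level_open enn2real_mult)
  then show ?case using Suc modulus_ge_1 by (simp add: field_simps)
qed


section \<open>Detecting a function by its integrals over cosets\<close>

text \<open>
  Suppose \<open>E = {g > r}\<close> had positive measure \<open>\<delta>\<close>. By regularity and interpolation there is a
  finite union \<open>W\<close> of cosets that differs from \<open>E\<close> by little. The integral of \<open>g\<close> over \<open>W\<close>
  vanishes, although \<open>W \<inter> E\<close> contributes about \<open>r \<delta>\<close> at least. The contribution of
  the small set \<open>W - E\<close> cannot compensate this, since \<open>g \<ge> - s - g\<^sup>2 / s\<close> for every \<open>s > 0\<close> and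
  \<open>g\<^sup>2\<close> is integrable.
\<close>

lemma AE_nonpos_if_coset_integrals_zero:
  fixes g :: "'a \<Rightarrow> real"
  assumes g: "g \<in> borel_measurable borel" and g2: "integrable m (\<lambda>x. (g x)\<^sup>2)"
    and zero: "\<And>p n. (LINT x:(+) p ` level n|m. g x) = 0"
  shows "AE x in m. g x \<le> 0"
proof -
  have *: "AE x in m. \<not> g x > r" if r: "r > 0" for r
  proof -
    define E where "E = {x. g x > r}"
    define M where "M = (LINT x|m. (g x)\<^sup>2)"
    have E: "E \<in> sets borel"
      using g unfolding E_def by measurable
    have M0: "M \<ge> 0" unfolding M_def by simp
    have "E \<subseteq> {x \<in> space m. (g x)\<^sup>2 \<ge> r\<^sup>2}"
      using r by (auto simp: E_def power2_eq_square intro!: mult_mono)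
    then have "emeasure m E \<le> emeasure m {x \<in> space m. (g x)\<^sup>2 \<ge> r\<^sup>2}"
      using g by (intro emeasure_mono) auto
    also have "\<dots> \<le> ennreal (1 / r\<^sup>2 * M)"
      unfolding M_def using g2 r by (intro integral_Markov_inequality) auto
    finally have E_fin: "emeasure m E < \<infinity>"
      by (rule le_less_trans) simp
    define \<delta> where "\<delta> = measure m E"
    have E_meas: "emeasure m E = ennreal \<delta>"
      using E_fin by (simp add: \<delta>_def emeasure_eq_ennreal_measure)
    have "\<delta> = 0"
    proof (rule ccontr)
      assume "\<delta> \<noteq> 0"
      then have d: "\<delta> > 0" by (simp add: \<delta>_def zero_less_measure_iff)
      \<comment> \<open>The error terms below are \<open>M / s\<close> and \<open>(r + s) e\<close>; each becomes at most \<open>r \<delta> / 4\<close>.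
        The summand \<open>1\<close> keeps \<open>s\<close> positive when \<open>M = 0\<close>.\<close>
      define s where "s = 4 * M / (r * \<delta>) + 1"
      define e where "e = (r * \<delta> / 4) / (r + s)"
      have s: "s > 0" using M0 r d by (simp add: s_def add_nonneg_pos)
      have e: "e > 0" using r d s by (simp add: e_def)
      have Ms: "M / s \<le> r * \<delta> / 4"
      proof -
        have "M \<le> (r * \<delta> / 4) * s"
          using r d by (simp add: s_def field_simps)
        then show ?thesis using s by (simp add: divide_le_eq)
      qed
      have es: "(r + s) * e = r * \<delta> / 4"
        using r s nonzero_eq_divide_eq[of "r + s" e "r * \<delta> / 4"] by (simp add: e_def mult.commute)
      have "(INF U\<in>{U. open U \<and> E \<subseteq> U}. emeasure m U) < ennreal (\<delta> + e)"
        using E_meas outer_regular[OF E] e d by (simp add: ennreal_less_iff)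
      then obtain U where U: "open U" "E \<subseteq> U" "emeasure m U < ennreal (\<delta> + e)"
        unfolding INF_less_iff by blast
      have Ufin: "emeasure m U < \<infinity>" using U(3) by (auto intro: less_trans)
      have U_meas: "emeasure m U = ennreal (measure m U)"
        using Ufin by (simp add: emeasure_eq_ennreal_measure)
      have U_less: "measure m U < \<delta> + e"
        using U(3) d e unfolding U_meas by (simp add: ennreal_less_iff del: ennreal_plus)
      have dU: "\<delta> \<le> measure m U"
        unfolding \<delta>_def by (rule measure_mono_fmeasurable[OF U(2)])
          (use E U Ufin in \<open>auto simp: fmeasurable_def\<close>)
      have "ennreal (measure m U - e) < (SUP K\<in>{K. compact K \<and> K \<subseteq> U}. emeasure m K)"
        using inner_regular[OF U(1)] e d dU unfolding U_meas
        by (metis diff_less_eq ennreal_lessI less_add_same_cancel1 less_le_trans)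
      then obtain C where C: "compact C" "C \<subseteq> U" "ennreal (measure m U - e) < emeasure m C"
        unfolding less_SUP_iff by blast
      obtain n where n: "C \<subseteq> \<Union> (cosets (level n) C)" "\<Union> (cosets (level n) C) \<subseteq> U"
        by (rule compact_open_interpolation[OF C(1) U(1) C(2)])
      \<comment> \<open>\<open>W\<close> and \<open>E\<close> both lie in \<open>U\<close> and fill it up to measure \<open>e\<close>.\<close>
      define W where "W = \<Union> (cosets (level n) C)"
      have WU: "W \<subseteq> U" using n(2) by (simp only: W_def)
      have fin: "finite (cosets (level n) C)"
        by (rule finite_cosets[OF level_subgroup level_open C(1)])
      have c_borel: "c \<in> sets borel" if "c \<in> cosets (level n) C" for c
        using that by (auto simp: cosets_def intro!: borel_open open_translate level_open)
      have W: "W \<in> sets borel" unfolding W_def using fin c_borel by auto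
      have Wfin: "emeasure m W < \<infinity>"
        using emeasure_mono[of W U m] n(2) U(1) Ufin unfolding W_def
        by (auto intro: le_less_trans)
      have meas: "S \<subseteq> U \<Longrightarrow> S \<in> sets borel \<Longrightarrow> S \<in> fmeasurable m" for S
        using emeasure_mono[of S U m] U(1) Ufin by (auto simp: fmeasurable_def intro: le_less_trans)
      have CW: "measure m U - e < measure m W"
      proof -
        have "ennreal (measure m U - e) < emeasure m W"
          using C(3) emeasure_mono[of C W m] n(1) W by (auto simp: W_def intro: less_le_trans)
        then show ?thesis
          using Wfin by (simp add: emeasure_eq_ennreal_measure ennreal_less_iff)
             (smt (verit) ennreal_less_iff ennreal_neg ennreal_0 measure_nonneg)
      qed
      have WE: "measure m (W - E) \<le> e"
      proof -
        have "measure m (W - E) \<le> measure m (U - E)"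
          using WU W E U(1) by (intro measure_mono_fmeasurable meas) auto
        also have "\<dots> = measure m U - \<delta>"
          unfolding \<delta>_def using U E by (intro measure_Diff) (auto simp: U_meas)
        finally show ?thesis using U_less by simp
      qed
      have EW: "measure m (W \<inter> E) \<ge> \<delta> - e"
      proof -
        have "\<delta> \<le> measure m ((W \<inter> E) \<union> (U - W))"
          unfolding \<delta>_def using U E W WU
          by (intro measure_mono_fmeasurable meas) auto
        also have "\<dots> \<le> measure m (W \<inter> E) + measure m (U - W)"
          using U E W by (intro measure_Un_le) auto
        also have "measure m (U - W) = measure m U - measure m W"
          using U W WU by (intro measure_Diff) (auto simp: U_meas)
        finally show ?thesis using CW by simp
      qed
      have g_int: "S \<subseteq> U \<Longrightarrow> S \<in> sets borel \<Longrightarrow> set_integrable m S g" for S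
        using L2_set_integrable[OF g, of S] g2 meas[of S] by (simp add: fmeasurable_def)
      have zeroW: "(LINT x:W|m. g x) = 0"
      proof -
        have "(LINT x:(\<Union>c\<in>cosets (level n) C. c)|m. g x)
            = (\<Sum>c\<in>cosets (level n) C. LINT x:c|m. g x)"
          using fin disjoint_cosets[OF level_subgroup] c_borel n(2)
          by (intro set_integral_finite_Union g_int) auto
        also have "\<dots> = 0" by (intro sum.neutral) (auto simp: cosets_def zero)
        finally show ?thesis by (simp add: W_def)
      qed
      have fm: "W \<inter> E \<in> fmeasurable m" "W - E \<in> fmeasurable m"
        using WU W E by (intro meas; auto)+
      have ind: "integrable m (\<lambda>x. r * indicator (W \<inter> E) x)"
        "integrable m (\<lambda>x. s * indicator (W - E) x)"
        using fm by (auto simp: fmeasurable_def intro!: integrable_mult_right integrable_real_indicator)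
      have "(LINT x|m. r * indicator (W \<inter> E) x - s * indicator (W - E) x - (g x)\<^sup>2 / s)
          \<le> (LINT x|m. indicator W x *\<^sub>R g x)"
      proof (rule integral_mono)
        show "integrable m (\<lambda>x. r * indicator (W \<inter> E) x - s * indicator (W - E) x - (g x)\<^sup>2 / s)"
          using ind g2 by (intro Bochner_Integration.integrable_diff integrable_divide)
        show "integrable m (\<lambda>x. indicator W x *\<^sub>R g x)"
          using g_int[OF WU W] by (simp add: set_integrable_def)
        fix x
        have "0 \<le> (g x)\<^sup>2 / s" using s by simp
        moreover have "- s - (g x)\<^sup>2 / s \<le> g x"
        proof -
          have "0 \<le> (g x + s / 2)\<^sup>2 + 3 / 4 * s\<^sup>2" by simp
          also have "\<dots> = s * (g x + s + (g x)\<^sup>2 / s)"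
            using s by (simp add: power2_eq_square field_simps)
          finally have "0 \<le> g x + s + (g x)\<^sup>2 / s" using s by (simp add: zero_le_mult_iff)
          then show ?thesis by simp
        qed
        ultimately show "r * indicator (W \<inter> E) x - s * indicator (W - E) x - (g x)\<^sup>2 / s
            \<le> indicator W x *\<^sub>R g x"
          by (auto simp: indicator_def E_def)
      qed
      also have "(LINT x|m. indicator W x *\<^sub>R g x) = 0"
        using zeroW by (simp add: set_lebesgue_integral_def)
      also have "(LINT x|m. r * indicator (W \<inter> E) x - s * indicator (W - E) x - (g x)\<^sup>2 / s)
          = r * measure m (W \<inter> E) - s * measure m (W - E) - M / s"
        using ind g2 W E by (simp add: M_def)
      finally have "r * measure m (W \<inter> E) \<le> s * measure m (W - E) + M / s" by simp
      moreover have "r * (\<delta> - e) \<le> r * measure m (W \<inter> E)" using EW r by simp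
      moreover have "s * measure m (W - E) \<le> s * e" using WE s by simp
      ultimately have "r * \<delta> \<le> (r + s) * e + M / s" by (simp add: algebra_simps)
      then have "r * \<delta> \<le> r * \<delta> / 2" using es Ms by linarith
      then show False using r d by simp
    qed
    then have "emeasure m E = 0" using E_meas by simp
    then show ?thesis
      using E by (intro AE_I[of _ _ E]) (auto simp: E_def)
  qed
  have "AE x in m. \<forall>j::nat. \<not> g x > 1 / real (Suc j)"
    unfolding AE_all_countable using * by simp
  then show ?thesis
  proof (rule AE_mp, intro AE_I2 impI)
    fix x assume x: "\<forall>j::nat. \<not> g x > 1 / real (Suc j)"
    show "g x \<le> 0"
    proof (rule ccontr)
      assume "\<not> g x \<le> 0"
      then obtain j where "inverse (real (Suc j)) < g x"
        using reals_Archimedean[of "g x"] by auto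
      with x show False by (simp add: inverse_eq_divide)
    qed
  qed
qed

text \<open>
  If all coset integrals of \<open>\<phi>\<close> vanish, so do those of the real parts of \<open>u \<phi>\<close> for every scalar
  \<open>u\<close>. The choices \<open>u = 1, -1, \<i>, -\<i>\<close> give both signs of the real and imaginary parts.
\<close>

lemma exists_coset_integral_nonzero:
  assumes \<phi>: "\<phi> \<in> L2 m" and nz: "\<not> (AE x in m. \<phi> x = 0)"
  obtains p n where "(LINT x:(+) p ` level n|m. \<phi> x) \<noteq> 0"
proof (rule ccontr)
  assume "\<not> thesis"
  with that have zero: "(LINT x:(+) p ` level n|m. \<phi> x) = 0" for p n by blast
  have meas: "\<phi> \<in> borel_measurable borel" and int: "integrable m (\<lambda>x. (cmod (\<phi> x))\<^sup>2)"
    using \<phi> by (auto simp: L2_def)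
  have nonpos: "AE x in m. Re (u * \<phi> x) \<le> 0" if u: "cmod u = 1" for u
  proof (rule AE_nonpos_if_coset_integrals_zero)
    show "(\<lambda>x. Re (u * \<phi> x)) \<in> borel_measurable borel" using meas by measurable
    have "(Re (u * \<phi> x))\<^sup>2 \<le> (cmod (\<phi> x))\<^sup>2" for x
      using abs_Re_le_cmod[of "u * \<phi> x"] u by (simp add: abs_le_square_iff[symmetric] norm_mult)
    then show "integrable m (\<lambda>x. (Re (u * \<phi> x))\<^sup>2)"
      using meas by (intro Bochner_Integration.integrable_bound[OF int]) auto
    fix p n
    have "set_integrable m ((+) p ` level n) \<phi>"
      by (intro L2_set_integrable meas int borel_open open_translate level_open
          emeasure_compact compact_translate level_compact)
    then have "integrable m (\<lambda>x. u * (indicator ((+) p ` level n) x *\<^sub>R \<phi> x))"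
      unfolding set_integrable_def by (rule integrable_mult_right)
    then have "Re (LINT x|m. u * (indicator ((+) p ` level n) x *\<^sub>R \<phi> x))
        = (LINT x|m. Re (u * (indicator ((+) p ` level n) x *\<^sub>R \<phi> x)))"
      by (rule integral_Re[symmetric])
    moreover have "(LINT x|m. u * (indicator ((+) p ` level n) x *\<^sub>R \<phi> x)) = 0"
      using zero[of p n] by (subst integral_mult_right_zero) (simp add: set_lebesgue_integral_def)
    moreover have "Re (u * (indicator S x *\<^sub>R \<phi> x)) = indicator S x *\<^sub>R Re (u * \<phi> x)" for S x
      by (simp add: indicator_def)
    ultimately show "(LINT x:(+) p ` level n|m. Re (u * \<phi> x)) = 0"
      by (simp only: set_lebesgue_integral_def) simp
  qed
  have "AE x in m. \<phi> x = 0"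
    using nonpos[of 1] nonpos[of "-1"] nonpos[of \<i>] nonpos[of "-\<i>"]
    by (auto simp: complex_eq_iff elim!: AE_mp)
  with nz show False ..
qed

end


section \<open>Gabor systems against modulated indicators of cosets\<close>

lemma emeasure_count_space_le:
  assumes "\<And>F. finite F \<Longrightarrow> F \<subseteq> S \<Longrightarrow> real (card F) \<le> r"
  shows "emeasure (count_space UNIV) S \<le> ennreal r"
proof (cases "finite S")
  case True
  then show ?thesis
    using assms[of S] by (simp add: emeasure_count_space_finite ennreal_of_nat_eq_real_of_nat)
next
  case False
  obtain F where "finite F" "card F = Suc (nat \<lceil>r\<rceil>)" "F \<subseteq> S"
    using infinite_arbitrarily_large[OF False] by blast
  then show ?thesis using assms[of F] by linarith
qed

lemma bessel_finite_sum_le: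
  assumes le: "(\<Sum>\<^sub>\<infinity>i\<in>I. ennreal ((cmod (L2_inner m f (g i)))\<^sup>2)) \<le> ennreal b"
    and F: "finite F" "F \<subseteq> I" and b: "b \<ge> 0"
  shows "(\<Sum>i\<in>F. (cmod (L2_inner m f (g i)))\<^sup>2) \<le> b"
proof -
  let ?t = "\<lambda>i. ennreal ((cmod (L2_inner m f (g i)))\<^sup>2)"
  have "ennreal (\<Sum>i\<in>F. (cmod (L2_inner m f (g i)))\<^sup>2) = infsum ?t F"
    using F by (simp add: sum_ennreal)
  also have "\<dots> \<le> infsum ?t I"
    using F by (intro infsum_mono_neutral nonneg_summable_on_complete) auto
  also have "\<dots> \<le> ennreal b" by (rule le)
  finally show ?thesis using b by simp
qed

lemma pairing_adjoint_funpow: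
  "A \<in> Aut \<Longrightarrow> pairing x ((adjoint_aut A ^^ n) \<eta>) = pairing ((A ^^ n) x) \<eta>"
  by (induction n arbitrary: x) (auto simp: pairing_adjoint funpow_swap1[of A])

context expansive_aut
begin

text \<open>
  The adjoint power moves \<open>A\<^sup>n\<close> to the other side of the pairing, where it cancels the \<open>A\<^sup>-\<^sup>n\<close> in the
  level. Hence frequencies from one box restrict to the same character on \<open>level n\<close>.
\<close>

lemma pairing_level_dilated_annihilator:
  assumes "h \<in> level n" and "\<eta> \<in> (adjoint_aut A ^^ n) ` annihilator H"
  shows "pairing h \<eta> = 1"
proof -
  have "(A ^^ n) ((inv A ^^ n) x) = x" for x
    by (induction n arbitrary: x)
      (use A_Aut in \<open>auto simp: funpow_swap1 Aut_def bij_is_surj surj_f_inv_f\<close>)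
  then show ?thesis
    using assms by (auto simp: level_def annihilator_def pairing_adjoint_funpow[OF A_Aut])
qed

definition modulated_indicator :: "'a dual \<Rightarrow> 'a set \<Rightarrow> 'a \<Rightarrow> complex" where
  "modulated_indicator \<xi> c y = indicator c y *\<^sub>R pairing y \<xi>"

lemma pairing_measurable: "(\<lambda>y. pairing y \<xi>) \<in> borel_measurable borel"
  by (intro borel_measurable_continuous_onI pairing_continuous)

text \<open>
  Characters have absolute value \<open>1\<close>, so the modulation does not affect norms.
\<close>

lemma modulated_indicator_L2:
  assumes "c \<in> sets borel" "emeasure m c < \<infinity>"
  shows "modulated_indicator \<xi> c \<in> L2 m"
    and "(L2_norm m (modulated_indicator \<xi> c))\<^sup>2 = measure m c"
proof -
  have sq: "(\<lambda>y. (cmod (modulated_indicator \<xi> c y))\<^sup>2) = (\<lambda>y. indicator c y :: real)"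
    by (auto simp: modulated_indicator_def indicator_def)
  have "modulated_indicator \<xi> c \<in> borel_measurable borel"
    unfolding modulated_indicator_def using assms pairing_measurable by measurable
  then show "modulated_indicator \<xi> c \<in> L2 m"
    using assms by (simp add: L2_def sq)
  show "(L2_norm m (modulated_indicator \<xi> c))\<^sup>2 = measure m c"
    using assms by (simp add: L2_norm_def sq)
qed

text \<open>
  On a coset of \<open>level n\<close> the product of the two characters is a unimodular constant, because their
  quotient is trivial on \<open>level n\<close>. What is left, after the translation is undone, is an
  integral of \<open>\<phi>\<close> over \<open>p + level n\<close>, the same for all these \<open>\<xi>\<close> and all \<open>x\<close>.
\<close>

lemma inner_modulated_indicator_gabor:
  assumes \<phi>: "\<phi> \<in> borel_measurable borel"
    and triv: "\<And>h. h \<in> level n \<Longrightarrow> pairing h \<xi> = pairing h \<xi>0"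
  shows "cmod (L2_inner m (modulated_indicator \<xi>0 ((+) x ` (+) p ` level n)) (gabor \<phi> (x, \<xi>)))
    = cmod (LINT y:(+) p ` level n|m. \<phi> y)"
proof -
  let ?S = "(+) p ` level n"
  define w where "w = pairing (x + p) \<xi>0 * cnj (pairing (x + p) \<xi>)"
  have w: "cmod w = 1" by (simp add: w_def norm_mult)
  have eq: "modulated_indicator \<xi>0 ((+) x ` ?S) y * cnj (gabor \<phi> (x, \<xi>) y)
      = w * cnj (indicator ((+) x ` ?S) y *\<^sub>R \<phi> (y - x))" for y
  proof (cases "y \<in> (+) x ` ?S")
    case True
    then obtain h where h: "h \<in> level n" "y = (x + p) + h" by (auto simp: add.assoc)
    have "pairing h \<xi>0 * cnj (pairing h \<xi>0) = 1"
      using complex_norm_square[of "pairing h \<xi>0"] by simp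
    then have "pairing y \<xi>0 * cnj (pairing y \<xi>) = w"
      using triv[OF h(1)] by (simp add: h(2) w_def pairing_add_left[of "x + p"])
    then show ?thesis
      using True by (simp add: modulated_indicator_def gabor_def modulation_def translation_def
          flip: mult.assoc)
  qed (simp add: modulated_indicator_def)
  have "L2_inner m (modulated_indicator \<xi>0 ((+) x ` ?S)) (gabor \<phi> (x, \<xi>))
      = w * cnj (LINT y:(+) x ` ?S|m. \<phi> (y - x))"
    unfolding L2_inner_def eq integral_mult_right_zero Bochner_Integration.integral_cnj set_lebesgue_integral_def ..
  also have "(LINT y:(+) x ` ?S|m. \<phi> (y - x)) = (LINT y:?S|m. \<phi> y)"
    by (intro set_integral_translate \<phi> borel_open open_translate level_open)
  finally show ?thesis by (simp add: norm_mult w)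
qed

text \<open>
  The integral over the large coset is the sum of the integrals over the small ones, and their
  number is \<open>\<Delta>\<^sup>n\<close> times the measure of \<open>level k\<close>; the claim is the Cauchy--Schwarz inequality
  for this sum.
\<close>

lemma sum_cosets_lower_bound:
  assumes \<phi>: "\<phi> \<in> L2 m" and kn: "k \<le> n"
  shows "(cmod (LINT y:(+) p ` level k|m. \<phi> y))\<^sup>2 \<le>
    \<Delta> ^ n * measure m (level k) *
      (\<Sum>c\<in>cosets (level n) ((+) p ` level k). (cmod (LINT y:c|m. \<phi> y))\<^sup>2)"
proof -
  let ?S = "(+) p ` level k"
  let ?D = "cosets (level n) ?S"
  have fin: "finite ?D"
    by (intro finite_cosets level_subgroup level_open compact_translate level_compact)
  have S: "compact ?S" "open ?S"
    by (intro compact_translate open_translate level_compact level_open)+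
  have UD: "\<Union> ?D = ?S"
  proof (rule Union_cosets[OF level_subgroup])
    fix s l assume "s \<in> ?S" "l \<in> level n"
    then have "s - p \<in> level k" "l \<in> level k"
      using level_antimono[OF kn] by (auto simp: mem_translate_iff)
    then have "(s - p) + l \<in> level k"
      using level_subgroup[of k] unfolding add_subgroup_def by blast
    then show "s + l \<in> ?S" unfolding mem_translate_iff by (simp add: algebra_simps)
  qed
  have "measure m ?S = real (card ?D) * measure m (level n)"
    using measure_finite_cosets[OF level_subgroup level_open level_compact fin]
    unfolding UD .
  moreover have "measure m ?S = measure m (level k)"
    by (simp add: measure_def emeasure_translate borel_open level_open)
  ultimately have card: "real (card ?D) = \<Delta> ^ n * measure m (level k)"
    using modulus_ge_1 by (simp add: measure_level[of n] field_simps)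
  have c_borel: "c \<in> sets borel" if "c \<in> ?D" for c
    using that by (auto simp: cosets_def intro!: borel_open open_translate level_open)
  have "(LINT y:(\<Union>c\<in>?D. c)|m. \<phi> y) = (\<Sum>c\<in>?D. LINT y:c|m. \<phi> y)"
  proof (rule set_integral_finite_Union[OF fin disjoint_cosets[OF level_subgroup]])
    fix c assume c: "c \<in> ?D"
    then obtain q where "c = (+) q ` level n" by (auto simp: cosets_def)
    then have "emeasure m c < \<infinity>"
      by (simp only: emeasure_compact compact_translate level_compact)
    then show "set_integrable m c \<phi>"
      using \<phi> c_borel[OF c] by (intro L2_set_integrable) (auto simp: L2_def)
  qed (use c_borel in auto)
  then have "cmod (LINT y:?S|m. \<phi> y) \<le> (\<Sum>c\<in>?D. cmod (LINT y:c|m. \<phi> y))"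
    by (simp add: UD norm_sum)
  then have "(cmod (LINT y:?S|m. \<phi> y))\<^sup>2 \<le> (\<Sum>c\<in>?D. cmod (LINT y:c|m. \<phi> y))\<^sup>2"
    by (intro power_mono) auto
  also have "\<dots> \<le> (\<Sum>c\<in>?D. (cmod (LINT y:c|m. \<phi> y))\<^sup>2) * card ?D"
    by (rule sum_squared_le_sum_of_squares)
  finally show ?thesis by (simp add: card mult_ac)
qed

text \<open>
  The Bessel inequality is summed over all test functions attached to the \<open>level n\<close> cosets \<open>c\<close> of
  \<open>x0 + p + A\<^sup>nH\<close>, modulated by the central frequency \<open>\<xi>0\<close>. Their squared norms
  add up to \<open>\<Delta>\<^sup>n\<close>. Conversely, for a point \<open>(x, \<xi>)\<close> of the box the cosets inside
  \<open>x + p + level k\<close> are among the \<open>c\<close>, and already they contribute at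
  least \<open>|\<integral> \<phi>|\<^sup>2\<close> over \<open>p + level k\<close>, divided by \<open>\<Delta>\<^sup>n\<close> and the measure of \<open>level k\<close>. So each
  point uses up a fixed share of a total, and the two factors \<open>\<Delta>\<^sup>n\<close> make up the volume of the box.
\<close>

lemma card_box_le:
  assumes \<phi>: "\<phi> \<in> L2 m" and kn: "k \<le> n" and B: "B > 0"
    and bessel: "\<And>f. f \<in> L2 m \<Longrightarrow>
      (\<Sum>\<^sub>\<infinity>z\<in>\<Lambda>. ennreal ((cmod (L2_inner m f (gabor \<phi> z)))\<^sup>2)) \<le> ennreal (B * (L2_norm m f)\<^sup>2)"
    and F: "finite F" "F \<subseteq> \<Lambda> \<inter> Q_box A H (int n) (x0, \<xi>0)"
  shows "real (card F) * (cmod (LINT y:(+) p ` level k|m. \<phi> y))\<^sup>2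
    \<le> B * measure m (level k) * \<Delta> ^ (2 * n)"
proof -
  define I where "I = (cmod (LINT y:(+) p ` level k|m. \<phi> y))\<^sup>2"
  let ?S = "(+) (x0 + p) ` dilated n"
  let ?C = "cosets (level n) ?S"
  let ?D = "cosets (level n) ((+) p ` level k)"
  let ?V = "\<lambda>z c. (cmod (L2_inner m (modulated_indicator \<xi>0 c) (gabor \<phi> z)))\<^sup>2"
  have \<phi>_meas: "\<phi> \<in> borel_measurable borel" using \<phi> by (simp add: L2_def)
  have fin: "finite ?C"
    by (intro finite_cosets level_subgroup level_open compact_translate dilated_compact)
  have UC: "\<Union> ?C = ?S"
  proof (rule Union_cosets[OF level_subgroup])
    fix s l assume "s \<in> ?S" "l \<in> level n"
    then have "s - (x0 + p) \<in> dilated n" "l \<in> dilated n"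
      using level_subset_dilated[of n n] by (auto simp: mem_translate_iff)
    then have "(s - (x0 + p)) + l \<in> dilated n"
      using dilated_subgroup[of n] unfolding add_subgroup_def by blast
    then show "s + l \<in> ?S" unfolding mem_translate_iff by (simp add: algebra_simps)
  qed
  have lower: "I \<le> \<Delta> ^ n * measure m (level k) * (\<Sum>c\<in>?C. ?V z c)" if z: "z \<in> F" for z
  proof -
    obtain x \<xi> where z_eq: "z = (x, \<xi>)" by (cases z)
    have x: "x - x0 \<in> dilated n" and \<xi>: "\<xi> - \<xi>0 \<in> (adjoint_aut A ^^ n) ` annihilator H"
      using z F(2) unfolding z_eq
      by (auto simp: Q_box_def aut_power_def dilated_def mem_translate_iff)
    have triv: "pairing h \<xi> = pairing h \<xi>0" if "h \<in> level n" for h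
      using pairing_level_dilated_annihilator[OF that \<xi>] pairing_add_right[of h \<xi>0 "\<xi> - \<xi>0"]
      by simp
    have sub: "(\<lambda>d. (+) x ` d) ` ?D \<subseteq> ?C"
    proof
      fix c assume "c \<in> (\<lambda>d. (+) x ` d) ` ?D"
      then obtain s where s: "s \<in> (+) p ` level k" "c = (+) x ` (+) s ` level n"
        unfolding cosets_def by blast
      have "(x - x0) + (s - p) \<in> dilated n"
        using x s(1) level_subset_dilated[of k n] dilated_subgroup[of n]
        unfolding add_subgroup_def mem_translate_iff by blast
      then have "x + s \<in> ?S" unfolding mem_translate_iff by (simp add: algebra_simps)
      then show "c \<in> ?C" unfolding s(2) translate_translate cosets_def by (rule imageI)
    qed
    have inj: "inj_on (\<lambda>d. (+) x ` d) ?D"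
      by (intro inj_onI) (simp add: inj_image_eq_iff)
    have "(\<Sum>d\<in>?D. (cmod (LINT y:d|m. \<phi> y))\<^sup>2) = (\<Sum>d\<in>?D. ?V z ((+) x ` d))"
    proof (rule sum.cong[OF refl])
      fix d assume "d \<in> ?D"
      then obtain q where "d = (+) q ` level n" by (auto simp: cosets_def)
      then show "(cmod (LINT y:d|m. \<phi> y))\<^sup>2 = ?V z ((+) x ` d)"
        by (simp only: z_eq inner_modulated_indicator_gabor[OF \<phi>_meas triv])
    qed
    also have "\<dots> = (\<Sum>c\<in>(\<lambda>d. (+) x ` d) ` ?D. ?V z c)"
      using inj by (simp only: sum.reindex comp_def)
    also have "\<dots> \<le> (\<Sum>c\<in>?C. ?V z c)"
      by (rule sum_mono2[OF fin sub]) simp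
    finally have "\<Delta> ^ n * measure m (level k) * (\<Sum>d\<in>?D. (cmod (LINT y:d|m. \<phi> y))\<^sup>2)
        \<le> \<Delta> ^ n * measure m (level k) * (\<Sum>c\<in>?C. ?V z c)"
      using modulus_ge_1 by (intro mult_left_mono) auto
    then show ?thesis
      using sum_cosets_lower_bound[OF \<phi> kn, of p] unfolding I_def by linarith
  qed
  have upper: "(\<Sum>z\<in>F. ?V z c) \<le> B * measure m (level n)" if c: "c \<in> ?C" for c
  proof -
    obtain q where q: "c = (+) q ` level n" using c by (auto simp: cosets_def)
    have cb: "c \<in> sets borel" "emeasure m c < \<infinity>"
      unfolding q by (intro borel_open open_translate level_open emeasure_compact
          compact_translate level_compact)+
    have "measure m c = measure m (level n)"
      unfolding q by (simp add: measure_def emeasure_translate borel_open level_open)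
    moreover have "(\<Sum>z\<in>F. ?V z c) \<le> B * (L2_norm m (modulated_indicator \<xi>0 c))\<^sup>2"
      using F B by (intro bessel_finite_sum_le[OF bessel] modulated_indicator_L2 cb) auto
    ultimately show ?thesis by (simp add: modulated_indicator_L2(2)[OF cb])
  qed
  have cardC: "real (card ?C) * measure m (level n) = \<Delta> ^ n"
  proof -
    have "measure m ?S = real (card ?C) * measure m (level n)"
      using measure_finite_cosets[OF level_subgroup level_open level_compact fin]
      unfolding UC .
    moreover have "measure m ?S = measure m (dilated n)"
      by (simp add: measure_def emeasure_translate borel_open dilated_open)
    ultimately show ?thesis by (simp add: measure_dilated)
  qed
  have "(\<Sum>z\<in>F. I) \<le> (\<Sum>z\<in>F. \<Delta> ^ n * measure m (level k) * (\<Sum>c\<in>?C. ?V z c))"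
    by (rule sum_mono) (rule lower)
  also have "\<dots> = \<Delta> ^ n * measure m (level k) * (\<Sum>c\<in>?C. \<Sum>z\<in>F. ?V z c)"
    by (subst sum.swap) (simp only: sum_distrib_left)
  also have "\<dots> \<le> \<Delta> ^ n * measure m (level k) * (\<Sum>c\<in>?C. B * measure m (level n))"
    using modulus_ge_1 by (intro mult_left_mono sum_mono upper) auto
  also have "\<dots> = \<Delta> ^ n * measure m (level k) * (B * (real (card ?C) * measure m (level n)))"
    by simp
  also have "\<dots> = B * measure m (level k) * \<Delta> ^ (2 * n)"
    unfolding cardC by (simp add: mult_2 power_add)
  finally show ?thesis by (simp add: I_def)
qed

end


section \<open>Finiteness of the upper density\<close>

theorem theorem5p1p1:
  fixes m :: "'a::{topological_ab_group_add, t2_space} measure"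
    and H :: "'a set" and A :: "'a \<Rightarrow> 'a"
    and \<phi> :: "'a \<Rightarrow> complex" and \<Lambda> :: "('a \<times> 'a dual) set"
  assumes "locally compact (UNIV :: 'a set)"
    and "add_subgroup H" and "compact H" and "open H"
    and "haar_measure m" and "emeasure m H = 1"
    and "A \<in> Aut" and "expansive A H"
    and "expansive (adjoint_aut A) (annihilator H)"
    and "\<phi> \<in> L2 m" and "\<not> (AE x in m. \<phi> x = 0)"
    and "bessel_sequence m \<Lambda> (gabor \<phi>)"
  shows "upper_density m A H \<Lambda> < \<infinity>"
proof -
  interpret expansive_aut m H A
    using assms by unfold_locales
  obtain p k where I: "(LINT y:(+) p ` level k|m. \<phi> y) \<noteq> 0"
    by (rule exists_coset_integral_nonzero[OF assms(10,11)])
  obtain B where B: "B > 0" and bessel: "\<And>f. f \<in> L2 m \<Longrightarrow>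
      (\<Sum>\<^sub>\<infinity>z\<in>\<Lambda>. ennreal ((cmod (L2_inner m f (gabor \<phi> z)))\<^sup>2)) \<le> ennreal (B * (L2_norm m f)\<^sup>2)"
    using assms(12) unfolding bessel_sequence_def by blast
  define K where "K = B * measure m (level k) / (cmod (LINT y:(+) p ` level k|m. \<phi> y))\<^sup>2"
  have bound: "ennreal (1 / \<Delta> ^ (2 * n)) *
      (SUP z. emeasure (count_space UNIV) (\<Lambda> \<inter> Q_box A H (int n) z)) \<le> ennreal K"
    if n: "k \<le> n" for n
  proof -
    have "emeasure (count_space UNIV) (\<Lambda> \<inter> Q_box A H (int n) z) \<le> ennreal (K * \<Delta> ^ (2 * n))" for z
    proof (rule emeasure_count_space_le)
      fix F assume F: "finite F" "F \<subseteq> \<Lambda> \<inter> Q_box A H (int n) z"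
      show "real (card F) \<le> K * \<Delta> ^ (2 * n)"
        using card_box_le[OF assms(10) n B bessel F(1), of "fst z" "snd z" p] F(2) I
        by (simp add: K_def field_simps)
    qed
    then have "(SUP z. emeasure (count_space UNIV) (\<Lambda> \<inter> Q_box A H (int n) z))
        \<le> ennreal (K * \<Delta> ^ (2 * n))"
      by (rule SUP_least)
    then have "ennreal (1 / \<Delta> ^ (2 * n)) *
        (SUP z. emeasure (count_space UNIV) (\<Lambda> \<inter> Q_box A H (int n) z))
        \<le> ennreal (1 / \<Delta> ^ (2 * n)) * ennreal (K * \<Delta> ^ (2 * n))"
      by (rule mult_left_mono) simp
    also have "\<dots> = ennreal K"
      using modulus_ge_1 by (subst ennreal_mult'[symmetric]) auto
    finally show ?thesis .
  qed
  have "upper_density m A H \<Lambda> \<le> ennreal K"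
    unfolding upper_density_def
    by (rule Limsup_bounded) (use bound in \<open>auto intro!: eventually_sequentiallyI[of k]\<close>)
  also have "\<dots> < \<infinity>" by simp
  finally show ?thesis .
qed

end
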